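(* Let $\Omega\subset X$ be a bounded domain that supports a $(1,1)$-Poincaré inequality. Assume that there is a constant $c_m>0$ such that $\mu(B(x,r)\cap\Omega)\ge c_m\,\mu(B(x,r))$ for all $x\in\partial\Omega$ and all $r\in(0,\operatorname{diam}(\Omega))$, and that there is a constant $C_{\partial\Omega}>0$ such that $$\mathcal H(B(x,r)\cap\partial\Omega)\le C_{\partial\Omega}\frac{\mu(B(x,r))}{r}$$ for all $x\in\partial\Omega$ and all $r\in(0,2\operatorname{diam}(\Omega))$. Then there is a constant $C_T=C_T(C_d,C_P,\lambda,\Omega,c_m)>0$ such that $$\int_{\partial\Omega}|Tu|\,d\mathcal H\le C_T\left(\int_\Omega|u|\,d\mu+\|Du\|(\Omega)\right)$$ for all $u\in\mathrm{BV}(\Omega)$, where $Tu$ denotes the trace of $u$ on $\partial\Omega$.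
   Context: Setting: $(X,d,\mu)$ is a complete metric space with a Borel regular outer measure $\mu$ that is doubling: there is $C_d>0$ with $0<\mu(B(x,2r))\le C_d\,\mu(B(x,r))<\infty$ for all $x\in X$, $r>0$. A nonnegative Borel function $g$ is an upper gradient of an extended real-valued function $u$ if for every rectifiable curve $\gamma$ (compact parameter interval) with end points $x,y$ one has $|u(x)-u(y)|\le\int_\gamma g\,ds$ when $u(x),u(y)$ are finite, and $\int_\gamma g\,ds=\infty$ otherwise. $X$ supports a $(1,1)$-Poincaré inequality: there are $C_P>0$, $\lambda\ge1$ such that for every ball $B(x,r)$, every locally integrable $u$ and every upper gradient $g$ of $u$, $\frac{1}{\mu(B(x,r))}\int_{B(x,r)}|u-u_{B(x,r)}|\,d\mu\le C_P\,r\,\frac{1}{\mu(B(x,\lambda r))}\int_{B(x,\lambda r)}g\,d\mu$, where $u_B=\frac{1}{\mu(B)}\int_B u\,d\mu$. "$\Omega$ supports a $(1,1)$-Poincaré inequality" means that the metric space $\Omega$, with the inherited metric and the restriction of $\mu$, satisfies such an inequality. A domain is a connected open set. BV: for an open set $\Omega$ and $u\in L^1_{\rm loc}(\Omega)$, $\|Du\|(\Omega):=\inf\{\liminf_{i\to\infty}\int_\Omega g_{u_i}\,d\mu:\ u_i\in \mathrm{Lip}_{\rm loc}(\Omega),\ u_i\to u \text{ in } L^1_{\rm loc}(\Omega)\}$, where each $g_{u_i}$ is an upper gradient of $u_i$ in $\Omega$; "loc" means on every open $\Omega'$ whose closure is a compact subset of $\Omega$. $\mathrm{BV}(\Omega)$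 is the set of $u\in L^1(\Omega)$ with $\|Du\|(\Omega)<\infty$. $\mathcal H$ is the codimension $1$ Hausdorff measure: $\mathcal H(A):=\lim_{R\to0}\mathcal H_R(A)$, with $\mathcal H_R(A):=\inf\{\sum_i \mu(B(x_i,r_i))/r_i:\ A\subset\bigcup_i B(x_i,r_i),\ r_i\le R\}$ (countable covers by balls). Trace: a function $Tu:\partial\Omega\to\mathbb R$ is the trace of a $\mu$-measurable function $u$ on $\Omega$ if for $\mathcal H$-a.e. $x\in\partial\Omega$, $\lim_{r\to0^+}\frac{1}{\mu(\Omega\cap B(x,r))}\int_{\Omega\cap B(x,r)}|u-Tu(x)|\,d\mu=0$. (Under the hypotheses of the statement every $u\in\mathrm{BV}(\Omega)$ has a trace, unique up to $\mathcal H$-null sets.) *)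

theory Defs
  imports "HOL-Analysis.Analysis"
begin

section \<open>Borel regular outer measures and doubling\<close>

definition borel_regular_outer_measure :: "('a::topological_space set \<Rightarrow> ennreal) \<Rightarrow> bool" where
  "borel_regular_outer_measure \<mu> \<longleftrightarrow>
     outer_measure_space (Pow UNIV) \<mu> \<and>
     sets borel \<subseteq> lambda_system UNIV (Pow UNIV) \<mu> \<and>
     (\<forall>A. \<exists>B\<in>sets borel. A \<subseteq> B \<and> \<mu> B = \<mu> A)"

text \<open>The measure obtained by restricting an outer measure to its Caratheodory-measurable sets;
  ``\<open>\<mu>\<close>-measurable'' and all integrals refer to it.\<close>

definition caratheodory_measure :: "('a set \<Rightarrow> ennreal) \<Rightarrow> 'a measure" where
  "caratheodory_measure \<mu> = measure_of UNIV (lambda_system UNIV (Pow UNIV) \<mu>) \<mu>"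

lemma
  assumes "outer_measure_space (Pow UNIV) \<mu>"
  shows sets_caratheodory_measure:
      "sets (caratheodory_measure \<mu>) = lambda_system UNIV (Pow UNIV) \<mu>"
    and emeasure_caratheodory_measure:
      "A \<in> lambda_system UNIV (Pow UNIV) \<mu> \<Longrightarrow> emeasure (caratheodory_measure \<mu>) A = \<mu> A"
proof -
  interpret sigma_algebra "UNIV :: 'a set" "Pow UNIV"
    by (rule sigma_algebra_Pow)
  have ms: "measure_space UNIV (lambda_system UNIV (Pow UNIV) \<mu>) \<mu>"
    using caratheodory_lemma[OF assms] by simp
  then interpret L: sigma_algebra UNIV "lambda_system UNIV (Pow UNIV) \<mu>"
    by (simp add: measure_space_def)
  show s: "sets (caratheodory_measure \<mu>) = lambda_system UNIV (Pow UNIV) \<mu>"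
    using L.sigma_sets_eq by (simp add: caratheodory_measure_def)
  show "emeasure (caratheodory_measure \<mu>) A = \<mu> A" if "A \<in> lambda_system UNIV (Pow UNIV) \<mu>"
    using ms that s
    by (intro emeasure_measure_of[OF caratheodory_measure_def]) (auto simp: measure_space_def)
qed

definition doubling :: "('a::metric_space set \<Rightarrow> ennreal) \<Rightarrow> real \<Rightarrow> bool" where
  "doubling \<mu> C\<^sub>d \<longleftrightarrow> C\<^sub>d > 0 \<and>
     (\<forall>x r. r > 0 \<longrightarrow>
        0 < \<mu> (ball x (2 * r)) \<and>
        \<mu> (ball x (2 * r)) \<le> ennreal C\<^sub>d * \<mu> (ball x r) \<and>
        ennreal C\<^sub>d * \<mu> (ball x r) < \<infinity>)"

section \<open>Rectifiable curves and line integrals\<close>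

definition curve_length :: "(real \<Rightarrow> 'a::metric_space) \<Rightarrow> real \<Rightarrow> real \<Rightarrow> ennreal" where
  "curve_length \<gamma> a b =
     (SUP ts\<in>{ts. sorted ts \<and> set ts \<subseteq> {a..b}}.
        \<Sum>i<length ts - 1. ennreal (dist (\<gamma> (ts ! i)) (\<gamma> (ts ! Suc i))))"

definition rectifiable_curve :: "(real \<Rightarrow> 'a::metric_space) \<Rightarrow> real \<Rightarrow> real \<Rightarrow> bool" where
  "rectifiable_curve \<gamma> a b \<longleftrightarrow> a \<le> b \<and> continuous_on {a..b} \<gamma> \<and> curve_length \<gamma> a b < \<infinity>"

text \<open>The arc-length parametrization on \<open>[0, length]\<close>. Since \<open>\<gamma>\<close> is constant on each interval where
  the length function is constant, the choice made by \<^const>\<open>inv_into\<close> does not matter; see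
  \<open>arclength_param_curve_length\<close> below.\<close>

definition arclength_param :: "(real \<Rightarrow> 'a::metric_space) \<Rightarrow> real \<Rightarrow> real \<Rightarrow> real \<Rightarrow> 'a" where
  "arclength_param \<gamma> a b s = \<gamma> (inv_into {a..b} (\<lambda>t. enn2real (curve_length \<gamma> a t)) s)"

definition line_integral ::
    "(real \<Rightarrow> 'a::metric_space) \<Rightarrow> real \<Rightarrow> real \<Rightarrow> ('a \<Rightarrow> ennreal) \<Rightarrow> ennreal" where
  "line_integral \<gamma> a b g =
     (\<integral>\<^sup>+s\<in>{0..enn2real (curve_length \<gamma> a b)}. g (arclength_param \<gamma> a b s) \<partial>lborel)"

lemma curve_length_mono: "t \<le> t' \<Longrightarrow> curve_length \<gamma> a t \<le> curve_length \<gamma> a t'"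
  unfolding curve_length_def by (rule SUP_subset_mono) auto

lemma curve_length_add_dist:
  assumes "a \<le> t" "t \<le> t'"
  shows "curve_length \<gamma> a t + ennreal (dist (\<gamma> t) (\<gamma> t')) \<le> curve_length \<gamma> a t'"
proof -
  let ?S = "\<lambda>ts. \<Sum>i<length ts - 1. ennreal (dist (\<gamma> (ts ! i)) (\<gamma> (ts ! Suc i)))"
  have le: "?S ts + ennreal (dist (\<gamma> t) (\<gamma> t')) \<le> curve_length \<gamma> a t'"
    if ts: "sorted ts" "set ts \<subseteq> {a..t}" for ts
  proof -
    have "?S ts + ennreal (dist (\<gamma> t) (\<gamma> t')) \<le> ?S (ts @ [t, t'])"
    proof (cases "ts = []")
      case False
      then obtain n where n: "length ts = Suc n" by (cases ts) auto
      have "?S (ts @ [t, t']) =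
        (\<Sum>i<n. ennreal (dist (\<gamma> ((ts @ [t, t']) ! i)) (\<gamma> ((ts @ [t, t']) ! Suc i))))
        + ennreal (dist (\<gamma> (ts ! n)) (\<gamma> t)) + ennreal (dist (\<gamma> t) (\<gamma> t'))"
        using n by (simp add: nth_append)
      also have "(\<Sum>i<n. ennreal (dist (\<gamma> ((ts @ [t, t']) ! i)) (\<gamma> ((ts @ [t, t']) ! Suc i)))) = ?S ts"
        using n by (intro sum.cong) (auto simp: nth_append)
      finally show ?thesis by (simp add: add.assoc add_left_mono)
    qed simp
    also have "\<dots> \<le> curve_length \<gamma> a t'"
      unfolding curve_length_def using ts assms
      by (intro SUP_upper) (force simp: sorted_append)
    finally show ?thesis .
  qed
  have "curve_length \<gamma> a t + ennreal (dist (\<gamma> t) (\<gamma> t')) =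
      (SUP ts\<in>{ts. sorted ts \<and> set ts \<subseteq> {a..t}}. ?S ts + ennreal (dist (\<gamma> t) (\<gamma> t')))"
    unfolding curve_length_def by (subst ennreal_SUP_add_left) (auto intro: exI[of _ "[]"])
  also have "\<dots> \<le> curve_length \<gamma> a t'"
    using le by (intro SUP_least) auto
  finally show ?thesis .
qed

lemma arclength_param_curve_length:
  assumes "curve_length \<gamma> a b < \<infinity>" "t \<in> {a..b}"
  shows "arclength_param \<gamma> a b (enn2real (curve_length \<gamma> a t)) = \<gamma> t"
proof -
  let ?l = "\<lambda>t. enn2real (curve_length \<gamma> a t)"
  define t' where "t' = inv_into {a..b} ?l (?l t)"
  have t': "t' \<in> {a..b}" "?l t' = ?l t"
    unfolding t'_def using assms(2) by (auto intro!: inv_into_into f_inv_into_f simp del: atLeastAtMost_iff)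
  have fin: "curve_length \<gamma> a s < \<infinity>" if "s \<in> {a..b}" for s
    using curve_length_mono[of s b \<gamma> a] assms(1) that by (auto intro: le_less_trans)
  have key: "\<gamma> p = \<gamma> q" if "p \<in> {a..b}" "q \<in> {a..b}" "p \<le> q" "?l p = ?l q" for p q
  proof -
    have "curve_length \<gamma> a p = curve_length \<gamma> a q"
      using that fin by (metis ennreal_enn2real infinity_ennreal_def)
    then have "curve_length \<gamma> a p + ennreal (dist (\<gamma> p) (\<gamma> q)) \<le> curve_length \<gamma> a p + 0"
      using curve_length_add_dist[of a p q \<gamma>] that by simp
    then show ?thesis
      using fin[OF that(1)] by (subst (asm) ennreal_add_left_cancel_le) auto
  qed
  show ?thesis
    using key[of t t'] key[of t' t] t' assms(2)
    unfolding arclength_param_def t'_def[symmetric] by (metis linear)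
qed

section \<open>Upper gradients and the Poincare inequality\<close>

text \<open>Below, \<open>Y\<close> is an open subset of the ambient space (possibly all of it), regarded as a metric
  measure space in its own right. Functions on \<open>Y\<close> are total functions whose values off \<open>Y\<close> are
  irrelevant.\<close>

definition upper_gradient_on ::
    "'a::metric_space set \<Rightarrow> ('a \<Rightarrow> ereal) \<Rightarrow> ('a \<Rightarrow> ennreal) \<Rightarrow> bool" where
  "upper_gradient_on Y u g \<longleftrightarrow>
     g \<in> borel_measurable (restrict_space borel Y) \<and>
     (\<forall>\<gamma> a b. rectifiable_curve \<gamma> a b \<and> \<gamma> ` {a..b} \<subseteq> Y \<longrightarrow>
        (if \<bar>u (\<gamma> a)\<bar> \<noteq> \<infinity> \<and> \<bar>u (\<gamma> b)\<bar> \<noteq> \<infinity>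
         then e2ennreal \<bar>u (\<gamma> a) - u (\<gamma> b)\<bar> \<le> line_integral \<gamma> a b g
         else line_integral \<gamma> a b g = \<infinity>))"

definition compactly_inside :: "'a::topological_space set \<Rightarrow> 'a set \<Rightarrow> bool" where
  "compactly_inside V Y \<longleftrightarrow> open V \<and> compact (closure V) \<and> closure V \<subseteq> Y"

definition locally_integrable_on ::
    "('a::metric_space set \<Rightarrow> ennreal) \<Rightarrow> 'a set \<Rightarrow> ('a \<Rightarrow> ereal) \<Rightarrow> bool" where
  "locally_integrable_on \<mu> Y u \<longleftrightarrow>
     u \<in> borel_measurable (restrict_space (caratheodory_measure \<mu>) Y) \<and>
     (\<forall>V. compactly_inside V Y \<longrightarrow>
        (\<integral>\<^sup>+y\<in>V. e2ennreal \<bar>u y\<bar> \<partial>caratheodory_measure \<mu>) < \<infinity>)"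

definition mean_value ::
    "('a set \<Rightarrow> ennreal) \<Rightarrow> 'a set \<Rightarrow> ('a \<Rightarrow> ereal) \<Rightarrow> real" where
  "mean_value \<mu> B u =
     (LINT y:B|caratheodory_measure \<mu>. real_of_ereal (u y)) / enn2real (\<mu> B)"

text \<open>The balls of the metric space \<open>Y\<close> are the sets \<open>ball x r \<inter> Y\<close> with \<open>x \<in> Y\<close>. In a proper space
  local integrability implies integrability on balls. A ball of an incomplete \<open>Y\<close> need not be
  relatively compact in \<open>Y\<close>; the inequality is then only required when \<open>u\<close> is integrable on
  the ball, that is, when its mean value is defined.\<close>

definition poincare_inequality_on ::
    "('a::metric_space set \<Rightarrow> ennreal) \<Rightarrow> 'a set \<Rightarrow> real \<Rightarrow> real \<Rightarrow> bool" where
  "poincare_inequality_on \<mu> Y C\<^sub>P \<Lambda> \<longleftrightarrow> C\<^sub>P > 0 \<and> \<Lambda> \<ge> 1 \<and>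
     (\<forall>x\<in>Y. \<forall>r>0. \<forall>u g.
        locally_integrable_on \<mu> Y u \<and> upper_gradient_on Y u g \<and>
        (\<integral>\<^sup>+y\<in>ball x r \<inter> Y. e2ennreal \<bar>u y\<bar> \<partial>caratheodory_measure \<mu>) < \<infinity> \<longrightarrow>
        (\<integral>\<^sup>+y\<in>ball x r \<inter> Y. e2ennreal \<bar>u y - ereal (mean_value \<mu> (ball x r \<inter> Y) u)\<bar>
            \<partial>caratheodory_measure \<mu>) / \<mu> (ball x r \<inter> Y)
        \<le> ennreal (C\<^sub>P * r) *
          ((\<integral>\<^sup>+y\<in>ball x (\<Lambda> * r) \<inter> Y. g y \<partial>caratheodory_measure \<mu>) / \<mu> (ball x (\<Lambda> * r) \<inter> Y)))"

definition supports_poincare :: "('a::metric_space set \<Rightarrow> ennreal) \<Rightarrow> 'a set \<Rightarrow> bool" where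
  "supports_poincare \<mu> Y \<longleftrightarrow> (\<exists>C \<Lambda>. poincare_inequality_on \<mu> Y C \<Lambda>)"

section \<open>Functions of bounded variation\<close>

definition locally_lipschitz_on :: "'a::metric_space set \<Rightarrow> ('a \<Rightarrow> real) \<Rightarrow> bool" where
  "locally_lipschitz_on \<Omega> v \<longleftrightarrow> (\<forall>V. compactly_inside V \<Omega> \<longrightarrow> (\<exists>L. L-lipschitz_on V v))"

definition tendsto_L1_loc ::
    "('a::metric_space set \<Rightarrow> ennreal) \<Rightarrow> 'a set \<Rightarrow> (nat \<Rightarrow> 'a \<Rightarrow> real) \<Rightarrow> ('a \<Rightarrow> real) \<Rightarrow> bool" where
  "tendsto_L1_loc \<mu> \<Omega> v u \<longleftrightarrow>
     (\<forall>V. compactly_inside V \<Omega> \<longrightarrow>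
        (\<lambda>i. \<integral>\<^sup>+y\<in>V. ennreal \<bar>v i y - u y\<bar> \<partial>caratheodory_measure \<mu>) \<longlonglongrightarrow> 0)"

definition total_variation ::
    "('a::metric_space set \<Rightarrow> ennreal) \<Rightarrow> 'a set \<Rightarrow> ('a \<Rightarrow> real) \<Rightarrow> ennreal" where
  "total_variation \<mu> \<Omega> u =
     Inf {liminf (\<lambda>i. \<integral>\<^sup>+y\<in>\<Omega>. g i y \<partial>caratheodory_measure \<mu>) | v g.
            (\<forall>i. locally_lipschitz_on \<Omega> (v i) \<and> upper_gradient_on \<Omega> (\<lambda>x. ereal (v i x)) (g i)) \<and>
            tendsto_L1_loc \<mu> \<Omega> v u}"

definition BV :: "('a::metric_space set \<Rightarrow> ennreal) \<Rightarrow> 'a set \<Rightarrow> ('a \<Rightarrow> real) set" where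
  "BV \<mu> \<Omega> = {u. set_integrable (caratheodory_measure \<mu>) \<Omega> u \<and> total_variation \<mu> \<Omega> u < \<infinity>}"

section \<open>Codimension one Hausdorff measure and traces\<close>

text \<open>Covers are indexed by an arbitrary set \<open>I\<close> of natural numbers so that finite covers are
  included: the radii are positive and \<open>\<mu>(B)/r\<close> need not tend to \<open>0\<close> as \<open>r\<close> does.\<close>

definition codim1_content :: "('a::metric_space set \<Rightarrow> ennreal) \<Rightarrow> real \<Rightarrow> 'a set \<Rightarrow> ennreal" where
  "codim1_content \<mu> R A =
     Inf {(\<Sum>\<^sub>\<infinity>i\<in>I. \<mu> (ball (x i) (r i)) / ennreal (r i)) | (I :: nat set) x r.
            A \<subseteq> (\<Union>i\<in>I. ball (x i) (r i)) \<and> (\<forall>i\<in>I. 0 < r i \<and> r i \<le> R)}"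

definition codim1_hausdorff :: "('a::metric_space set \<Rightarrow> ennreal) \<Rightarrow> 'a set \<Rightarrow> ennreal" where
  "codim1_hausdorff \<mu> A = Lim (at_right 0) (\<lambda>R. codim1_content \<mu> R A)"

lemma codim1_content_antimono: "R \<le> R' \<Longrightarrow> codim1_content \<mu> R' A \<le> codim1_content \<mu> R A"
  unfolding codim1_content_def by (rule Inf_superset_mono) (fastforce intro: order_trans)

lemma tendsto_codim1_content:
  "((\<lambda>R. codim1_content \<mu> R A) \<longlongrightarrow> (SUP R\<in>{0<..}. codim1_content \<mu> R A)) (at_right 0)"
proof (rule order_tendstoI)
  fix c assume "c < (SUP R\<in>{0<..}. codim1_content \<mu> R A)"
  then obtain R where "R > 0" "c < codim1_content \<mu> R A"
    by (auto simp: less_SUP_iff)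
  then show "\<forall>\<^sub>F R in at_right 0. c < codim1_content \<mu> R A"
    unfolding eventually_at_right_field
    by (intro exI[of _ R]) (auto intro: less_le_trans[OF _ codim1_content_antimono[of _ R]])
next
  fix c assume c: "(SUP R\<in>{0<..}. codim1_content \<mu> R A) < c"
  have "codim1_content \<mu> R A < c" if "R > 0" for R
    using SUP_upper[of R "{0<..}" "\<lambda>R. codim1_content \<mu> R A"] that c by auto
  then show "\<forall>\<^sub>F R in at_right 0. codim1_content \<mu> R A < c"
    unfolding eventually_at_right_field by (intro exI[of _ 1]) auto
qed

lemma codim1_hausdorff_eq_SUP:
  "codim1_hausdorff \<mu> A = (SUP R\<in>{0<..}. codim1_content \<mu> R A)"
  unfolding codim1_hausdorff_def by (rule tendsto_Lim[OF _ tendsto_codim1_content]) simp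

definition is_trace ::
    "('a::metric_space set \<Rightarrow> ennreal) \<Rightarrow> 'a set \<Rightarrow> ('a \<Rightarrow> real) \<Rightarrow> ('a \<Rightarrow> real) \<Rightarrow> bool" where
  "is_trace \<mu> \<Omega> u T \<longleftrightarrow>
     (AE x in caratheodory_measure (codim1_hausdorff \<mu>). x \<in> frontier \<Omega> \<longrightarrow>
        ((\<lambda>r. (\<integral>\<^sup>+y\<in>\<Omega> \<inter> ball x r. ennreal \<bar>u y - T x\<bar> \<partial>caratheodory_measure \<mu>)
               / \<mu> (\<Omega> \<inter> ball x r)) \<longlongrightarrow> 0) (at_right 0))"

end

theory Submission
  imports Defs
begin

text \<open>For almost every level \<open>t > 0\<close> the Hausdorff measure of \<open>{\<bar>Tu\<bar> > t}\<close> is estimated by a boxing argument. At a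
  boundary point with \<open>\<bar>Tu\<bar> > t\<close> the set \<open>E\<^sub>t = {\<bar>u\<bar> > t}\<close> has relative density one. Either \<open>E\<^sub>t\<close> still fills
  half of \<open>\<Omega>\<close> in the ball of a fixed radius, so that \<open>\<mu> E\<^sub>t\<close> is bounded below and the finite measure of the
  boundary can be absorbed, or there is a radius at which both \<open>E\<^sub>t\<close> and its complement occupy a definite
  portion of the ball. There the Poincare inequality, applied to ramps of slope \<open>1 / h\<^sub>n\<close> across the level \<open>t\<close>
  of locally Lipschitz approximations of \<open>u\<close>, bounds \<open>\<mu>(B) / r\<close> by the energy of the ramps in an enlarged ball.
  A Vitali covering sums these bounds. Integrating in \<open>t\<close> with Fatou's lemma and Tonelli's theorem recovers the
  energies of the approximations, hence the total variation.\<close>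

section \<open>Arc length\<close>

text \<open>The stopping radii do not tend to zero, so a Vitali cover at these radii alone controls
  only the content at a fixed scale. The assumed upper bound for \<open>codim1_hausdorff\<close> on
  boundary balls is what turns \<mu>(B)/r into a bound for the Hausdorff measure itself. The
  approximations of \<open>u\<close> are chosen once, independently of \<open>t\<close>; only the
  ramps depend on the level. The approximations converge to \<open>u\<close> in L^1 only locally, so
  they are first made to converge almost everywhere. Then for every \<open>t\<close> with {|u| = t}
  null the ramps converge to the indicator of E_t in L^1 of the whole domain. A ramp needs an upper
  gradient supported in its band, since otherwise the integral over \<open>t\<close> would diverge.
  Cutting off an upper gradient is justified curve by curve, by passing to a subcurve that carries
  the whole change of the ramp. This is the reason for the study of arc length: a line integral is
  here an integral along the arc-length parametrization, which is defined through a chosen inverse,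
  so its additivity and measurability have to be derived.\<close>

fun poly_length :: "(real \<Rightarrow> 'a::metric_space) \<Rightarrow> real list \<Rightarrow> ennreal" where
  "poly_length \<gamma> [] = 0"
| "poly_length \<gamma> [x] = 0"
| "poly_length \<gamma> (x # y # ts) = ennreal (dist (\<gamma> x) (\<gamma> y)) + poly_length \<gamma> (y # ts)"

text \<open>The recursive form turns insertion and concatenation of partition points into inductions
  on the list, which the indexed sum in \<open>curve_length_def\<close> does not offer
  directly.\<close>

lemma poly_length_eq_sum:
  "poly_length \<gamma> ts = (\<Sum>i<length ts - 1. ennreal (dist (\<gamma> (ts ! i)) (\<gamma> (ts ! Suc i))))"
proof (induction \<gamma> ts rule: poly_length.induct)
  case (3 \<gamma> x y ts)
  then show ?case
    by (simp add: sum.lessThan_Suc_shift del: sum.lessThan_Suc)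
qed auto

lemma curve_length_eq_SUP:
  "curve_length \<gamma> a b = (SUP ts\<in>{ts. sorted ts \<and> set ts \<subseteq> {a..b}}. poly_length \<gamma> ts)"
  unfolding curve_length_def poly_length_eq_sum ..

lemma poly_length_le_curve_length:
  "sorted ts \<Longrightarrow> set ts \<subseteq> {a..b} \<Longrightarrow> poly_length \<gamma> ts \<le> curve_length \<gamma> a b"
  unfolding curve_length_eq_SUP by (rule SUP_upper) auto

lemma poly_length_append:
  "poly_length \<gamma> (xs @ c # ys) = poly_length \<gamma> (xs @ [c]) + poly_length \<gamma> (c # ys)"
proof (induction \<gamma> xs rule: poly_length.induct)
  case (2 \<gamma> x)
  then show ?case by (cases ys) auto
qed (auto simp: add.assoc)

text \<open>Triangle inequality through the inserted point; hence any partition may be refined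
  without losing length.\<close>

lemma poly_length_insert_le: "poly_length \<gamma> (xs @ ys) \<le> poly_length \<gamma> (xs @ c # ys)"
proof (induction \<gamma> xs rule: poly_length.induct)
  case (1 \<gamma>)
  then show ?case by (cases ys) auto
next
  case (2 \<gamma> x)
  show ?case
  proof (cases ys)
    case (Cons y zs)
    have "ennreal (dist (\<gamma> x) (\<gamma> y)) \<le> ennreal (dist (\<gamma> x) (\<gamma> c)) + ennreal (dist (\<gamma> c) (\<gamma> y))"
      by (metis dist_triangle ennreal_leI ennreal_plus zero_le_dist)
    then show ?thesis using Cons by (auto simp: add.assoc[symmetric] intro: add_right_mono)
  qed auto
qed (auto intro: add_left_mono)

text \<open>The partition points avoid the open interval between \<open>x\<close> and \<open>y\<close>, so both can be inserted next to
  each other.\<close>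

lemma poly_length_gap_le:
  assumes "sorted ts" "set ts \<subseteq> {a..b}" "a \<le> x" "x \<le> y" "y \<le> b" "set ts \<inter> {x<..<y} = {}"
  shows "poly_length \<gamma> ts \<le> curve_length \<gamma> a x + ennreal (dist (\<gamma> x) (\<gamma> y)) + curve_length \<gamma> y b"
proof -
  define xs where "xs = takeWhile (\<lambda>t. t \<le> x) ts"
  define ys where "ys = dropWhile (\<lambda>t. t \<le> x) ts"
  have ts: "ts = xs @ ys" by (simp add: xs_def ys_def)
  have xs: "\<forall>t\<in>set xs. t \<le> x" unfolding xs_def using set_takeWhileD by fastforce
  have s: "sorted xs" "sorted ys" using assms(1) ts by (auto simp: sorted_append)
  have ys: "\<forall>t\<in>set ys. y \<le> t"
  proof (cases ys)
    case (Cons t zs)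
    then have "\<not> t \<le> x"
      unfolding ys_def by (rule dropWhile_eq_Cons_conv[THEN iffD1, THEN conjunct2])
    then have "y \<le> t" using assms(6) ts Cons by auto
    then show ?thesis using s(2) Cons by auto
  qed auto
  have "poly_length \<gamma> ts \<le> poly_length \<gamma> (xs @ x # y # ys)"
    unfolding ts by (metis order_trans poly_length_insert_le)
  also have "\<dots> = poly_length \<gamma> (xs @ [x]) + (ennreal (dist (\<gamma> x) (\<gamma> y)) + poly_length \<gamma> (y # ys))"
    using poly_length_append[of \<gamma> xs x "y # ys"] by simp
  also have "\<dots> \<le> curve_length \<gamma> a x + (ennreal (dist (\<gamma> x) (\<gamma> y)) + curve_length \<gamma> y b)"
    using assms s xs ys ts
    by (intro add_mono poly_length_le_curve_length) (auto simp: sorted_append)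
  finally show ?thesis by (simp add: add.assoc)
qed

text \<open>A partition is split at \<open>c\<close> by taking the empty gap
  \<open>x = y = c\<close> in \<open>poly_length_gap_le\<close>; conversely, two partitions are
  joined through \<open>c\<close>. The two suprema are pulled out one after the other, as addition
  in \<open>ennreal\<close> commutes with suprema over nonempty sets.\<close>

lemma curve_length_additive:
  assumes "a \<le> c" "c \<le> b"
  shows "curve_length \<gamma> a b = curve_length \<gamma> a c + curve_length \<gamma> c b"
proof (rule antisym)
  show "curve_length \<gamma> a b \<le> curve_length \<gamma> a c + curve_length \<gamma> c b"
    unfolding curve_length_eq_SUP[of \<gamma> a b]
    using poly_length_gap_le[of _ a b c c \<gamma>] assms by (intro SUP_least) auto
  have *: "poly_length \<gamma> xs + poly_length \<gamma> ys \<le> curve_length \<gamma> a b"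
    if "sorted xs" "set xs \<subseteq> {a..c}" "sorted ys" "set ys \<subseteq> {c..b}" for xs ys
  proof -
    have "poly_length \<gamma> xs \<le> poly_length \<gamma> (xs @ [c])"
      using poly_length_insert_le[of \<gamma> xs "[]" c] by simp
    moreover have "poly_length \<gamma> ys \<le> poly_length \<gamma> (c # ys)"
      using poly_length_insert_le[of \<gamma> "[]" ys c] by simp
    ultimately have "poly_length \<gamma> xs + poly_length \<gamma> ys \<le> poly_length \<gamma> (xs @ c # ys)"
      using poly_length_append[of \<gamma> xs c ys] by (simp only: add_mono)
    also have "\<dots> \<le> curve_length \<gamma> a b"
      using that assms by (intro poly_length_le_curve_length) (fastforce simp: sorted_append)+
    finally show ?thesis .
  qed
  have ne: "{ts. sorted ts \<and> set ts \<subseteq> {x..y}} \<noteq> {}" for x y :: real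
    by (auto intro: exI[of _ "[]"])
  have "curve_length \<gamma> a c + poly_length \<gamma> ys \<le> curve_length \<gamma> a b"
    if "sorted ys" "set ys \<subseteq> {c..b}" for ys
    unfolding curve_length_eq_SUP[of \<gamma> a c] ennreal_SUP_add_left[OF ne, symmetric]
    using * that by (intro SUP_least) auto
  then show "curve_length \<gamma> a c + curve_length \<gamma> c b \<le> curve_length \<gamma> a b"
    unfolding curve_length_eq_SUP[of \<gamma> c b] ennreal_SUP_add_right[OF ne]
    by (intro SUP_least) auto
qed

lemma curve_length_self [simp]: "curve_length \<gamma> a a = 0"
proof -
  have "poly_length \<gamma> ts = 0" if "set ts \<subseteq> {a}" for ts
    using that by (induction \<gamma> ts rule: poly_length.induct) auto
  then show ?thesis unfolding curve_length_eq_SUP by (auto intro!: antisym SUP_least)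
qed

lemma curve_length_finite:
  assumes "rectifiable_curve \<gamma> a b" "a \<le> x" "x \<le> y" "y \<le> b"
  shows "curve_length \<gamma> x y < \<infinity>"
proof -
  have "curve_length \<gamma> x y \<le> curve_length \<gamma> a b"
    using assms curve_length_additive[of a x b \<gamma>] curve_length_additive[of x y b \<gamma>]
    by (simp add: add_increasing add_increasing2)
  then show ?thesis using assms(1) by (auto simp: rectifiable_curve_def)
qed

lemma arclength_diff:
  assumes "rectifiable_curve \<gamma> a b" "a \<le> x" "x \<le> y" "y \<le> b"
  shows "enn2real (curve_length \<gamma> a y) = enn2real (curve_length \<gamma> a x) + enn2real (curve_length \<gamma> x y)"
  unfolding curve_length_additive[OF assms(2,3)]
  using curve_length_finite[OF assms(1), of a x] curve_length_finite[OF assms(1), of x y] assms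
  by (intro enn2real_plus) auto

text \<open>\<open>F\<close> is a partition whose polygonal length falls short of the curve length
  by at most \<open>e\<close>. Inside one of its gaps the arc cannot exceed the chord by more than
  this total deficit.\<close>

lemma arclength_small_gap:
  assumes \<gamma>: "rectifiable_curve \<gamma> a b" and "e > 0"
  obtains F where "finite F"
    "\<And>x y. a \<le> x \<Longrightarrow> x \<le> y \<Longrightarrow> y \<le> b \<Longrightarrow> F \<inter> {x<..<y} = {} \<Longrightarrow>
       enn2real (curve_length \<gamma> x y) \<le> dist (\<gamma> x) (\<gamma> y) + e"
proof -
  have ab: "a \<le> b" using \<gamma> by (auto simp: rectifiable_curve_def)
  obtain l where l: "curve_length \<gamma> a b = ennreal l" "l \<ge> 0"
    using curve_length_finite[OF \<gamma>, of a b] ab by (cases "curve_length \<gamma> a b") auto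
  have "\<exists>ts. sorted ts \<and> set ts \<subseteq> {a..b} \<and> curve_length \<gamma> a b \<le> poly_length \<gamma> ts + ennreal e"
  proof (rule ccontr)
    assume *: "\<not> ?thesis"
    have lt: "poly_length \<gamma> ts + ennreal e < ennreal l" if "sorted ts" "set ts \<subseteq> {a..b}" for ts
      using * that l(1) by (metis not_le)
    have "curve_length \<gamma> a b \<le> ennreal (l - e)"
      unfolding curve_length_eq_SUP[of \<gamma> a b]
    proof (rule SUP_least)
      fix ts assume ts: "ts \<in> {ts. sorted ts \<and> set ts \<subseteq> {a..b}}"
      then have *: "poly_length \<gamma> ts + ennreal e < ennreal l" using lt by blast
      then obtain p where "poly_length \<gamma> ts = ennreal p" "p \<ge> 0"
        by (cases "poly_length \<gamma> ts") auto
      then show "poly_length \<gamma> ts \<le> ennreal (l - e)"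
        using * \<open>e > 0\<close> by (simp flip: ennreal_plus add: ennreal_less_iff ennreal_leI)
    qed
    \<comment> \<open>The empty partition yields \<open>e < l\<close>. Without it
      \<open>ennreal (l - e)\<close> could be truncated to 0, and the bound above would not be
      contradictory.\<close>
    moreover have "poly_length \<gamma> [] + ennreal e < ennreal l"
      by (rule lt) auto
    ultimately show False
      using l \<open>e > 0\<close> by (simp add: ennreal_less_iff)
  qed
  then obtain ts where ts: "sorted ts" "set ts \<subseteq> {a..b}"
    "curve_length \<gamma> a b \<le> poly_length \<gamma> ts + ennreal e" by blast
  show thesis
  proof
    show "finite (set ts)" by simp
    fix x y assume xy: "a \<le> x" "x \<le> y" "y \<le> b" "set ts \<inter> {x<..<y} = {}"
    let ?L = "\<lambda>p q. enn2real (curve_length \<gamma> p q)"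
    have fin: "curve_length \<gamma> p q = ennreal (?L p q)" if "a \<le> p" "p \<le> q" "q \<le> b" for p q
      using curve_length_finite[OF \<gamma> that] by simp
    have "curve_length \<gamma> a b \<le> curve_length \<gamma> a x + ennreal (dist (\<gamma> x) (\<gamma> y)) + curve_length \<gamma> y b + ennreal e"
      using ts poly_length_gap_le[OF ts(1,2) xy, of \<gamma>] by (meson add_right_mono order_trans)
    then have "ennreal (?L a b) \<le> ennreal (?L a x + dist (\<gamma> x) (\<gamma> y) + ?L y b + e)"
      using fin[of a b] fin[of a x] fin[of y b] xy \<open>e > 0\<close> by simp
    then have "?L a b \<le> ?L a x + dist (\<gamma> x) (\<gamma> y) + ?L y b + e"
      using \<open>e > 0\<close> by (subst (asm) ennreal_le_iff) auto
    moreover have "?L a b = ?L a y + ?L y b" "?L a y = ?L a x + ?L x y"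
      using arclength_diff[OF \<gamma>, of y b] arclength_diff[OF \<gamma>, of x y] xy by auto
    ultimately show "?L x y \<le> dist (\<gamma> x) (\<gamma> y) + e" by simp
  qed
qed

lemma continuous_on_arclength:
  assumes \<gamma>: "rectifiable_curve \<gamma> a b"
  shows "continuous_on {a..b} (\<lambda>t. enn2real (curve_length \<gamma> a t))"
  unfolding continuous_on_iff
proof (intro ballI allI impI)
  let ?L = "\<lambda>t. enn2real (curve_length \<gamma> a t)"
  fix c e :: real assume c: "c \<in> {a..b}" and e: "e > 0"
  obtain F where F: "finite F"
    "\<And>x y. a \<le> x \<Longrightarrow> x \<le> y \<Longrightarrow> y \<le> b \<Longrightarrow> F \<inter> {x<..<y} = {} \<Longrightarrow>
       enn2real (curve_length \<gamma> x y) \<le> dist (\<gamma> x) (\<gamma> y) + e / 2"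
    using arclength_small_gap[OF \<gamma>, of "e / 2"] e by auto
  \<comment> \<open>Only points of \<open>F\<close> strictly between \<open>x\<close> and
    \<open>c\<close> can spoil the gap, so \<open>c\<close> itself is left out when the distance
    \<open>d1\<close> is chosen.\<close>
  obtain d1 where d1: "d1 > 0" "\<And>x. x \<in> F \<Longrightarrow> x \<noteq> c \<Longrightarrow> d1 \<le> dist c x"
    using finite_set_avoid[OF F(1), of c] by auto
  have "continuous_on {a..b} \<gamma>" using \<gamma> by (simp add: rectifiable_curve_def)
  then obtain d2 where d2: "d2 > 0" "\<And>x. x \<in> {a..b} \<Longrightarrow> dist x c < d2 \<Longrightarrow> dist (\<gamma> x) (\<gamma> c) < e / 2"
    using c e unfolding continuous_on_iff by (meson half_gt_zero)
  show "\<exists>d>0. \<forall>x\<in>{a..b}. dist x c < d \<longrightarrow> dist (?L x) (?L c) < e"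
  proof (intro exI[of _ "min d1 d2"] conjI ballI impI)
    fix x assume x: "x \<in> {a..b}" "dist x c < min d1 d2"
    have "F \<inter> {min x c<..<max x c} = {}"
      using d1(2) x by (force simp: dist_real_def)
    then have "enn2real (curve_length \<gamma> (min x c) (max x c)) \<le> dist (\<gamma> (min x c)) (\<gamma> (max x c)) + e / 2"
      using x c by (intro F) auto
    also have "\<dots> < e"
      using d2(2)[of x] x by (cases "x \<le> c") (auto simp: dist_commute)
    finally have "enn2real (curve_length \<gamma> (min x c) (max x c)) < e" .
    moreover have "?L (max x c) = ?L (min x c) + enn2real (curve_length \<gamma> (min x c) (max x c))"
      using x c by (intro arclength_diff[OF \<gamma>]) auto
    ultimately show "dist (?L x) (?L c) < e"
      by (auto simp: dist_real_def min_def max_def split: if_splits)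
  qed (use d1 d2 in auto)
qed

lemma arclength_surj:
  assumes \<gamma>: "rectifiable_curve \<gamma> a b" and "s \<in> {0..enn2real (curve_length \<gamma> a b)}"
  obtains t where "t \<in> {a..b}" "enn2real (curve_length \<gamma> a t) = s"
proof -
  have "a \<le> b" using \<gamma> by (auto simp: rectifiable_curve_def)
  then show thesis
    using IVT'[of "\<lambda>t. enn2real (curve_length \<gamma> a t)" a s b] continuous_on_arclength[OF \<gamma>] assms(2) that
    by auto
qed

text \<open>Arc length dominates chord length. The resulting continuity is what makes a Borel
  function along the parametrization measurable.\<close>

lemma arclength_param_lipschitz:
  assumes \<gamma>: "rectifiable_curve \<gamma> a b"
  shows "1-lipschitz_on {0..enn2real (curve_length \<gamma> a b)} (arclength_param \<gamma> a b)"
proof (rule lipschitz_onI)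
  let ?L = "\<lambda>t. enn2real (curve_length \<gamma> a t)"
  fix s s' assume s: "s \<in> {0..?L b}" "s' \<in> {0..?L b}"
  obtain t t' where t: "t \<in> {a..b}" "?L t = s" "t' \<in> {a..b}" "?L t' = s'"
    using s arclength_surj[OF \<gamma>] by metis
  have fin: "curve_length \<gamma> a b < \<infinity>" using \<gamma> by (simp add: rectifiable_curve_def)
  have le: "dist (\<gamma> p) (\<gamma> q) \<le> ?L q - ?L p" if "p \<in> {a..b}" "q \<in> {a..b}" "p \<le> q" for p q
  proof -
    have "ennreal (dist (\<gamma> p) (\<gamma> q)) \<le> curve_length \<gamma> p q"
      using poly_length_le_curve_length[of "[p, q]" p q \<gamma>] that by simp
    also have "\<dots> = ennreal (enn2real (curve_length \<gamma> p q))"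
      using that curve_length_finite[OF \<gamma>, of p q] by simp
    finally have "dist (\<gamma> p) (\<gamma> q) \<le> enn2real (curve_length \<gamma> p q)"
      by (simp only: ennreal_le_iff enn2real_nonneg)
    then show ?thesis
      using that arclength_diff[OF \<gamma>, of p q] by simp
  qed
  have "dist (\<gamma> t) (\<gamma> t') \<le> dist s s'"
    using le[of t t'] le[of t' t] t by (cases "t \<le> t'") (auto simp: dist_real_def dist_commute)
  then show "dist (arclength_param \<gamma> a b s) (arclength_param \<gamma> a b s') \<le> 1 * dist s s'"
    using arclength_param_curve_length[OF fin t(1)] arclength_param_curve_length[OF fin t(3)] t by simp
qed simp

lemma arclength_param_in:
  assumes \<gamma>: "rectifiable_curve \<gamma> a b" and "s \<in> {0..enn2real (curve_length \<gamma> a b)}"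
  shows "arclength_param \<gamma> a b s \<in> \<gamma> ` {a..b}"
proof -
  obtain t where t: "t \<in> {a..b}" "enn2real (curve_length \<gamma> a t) = s"
    using arclength_surj[OF assms] .
  moreover have "curve_length \<gamma> a b < \<infinity>"
    using \<gamma> by (simp add: rectifiable_curve_def)
  ultimately have "arclength_param \<gamma> a b s = \<gamma> t"
    using arclength_param_curve_length by metis
  then show ?thesis using t by blast
qed

lemma measurable_comp_arclength_param:
  fixes g :: "'a::metric_space \<Rightarrow> ennreal"
  assumes \<gamma>: "rectifiable_curve \<gamma> a b" "\<gamma> ` {a..b} \<subseteq> Y"
    and g: "g \<in> borel_measurable (restrict_space borel Y)"
  shows "(\<lambda>s. g (arclength_param \<gamma> a b s) * indicator {0..enn2real (curve_length \<gamma> a b)} s) \<in> borel_measurable borel"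
proof -
  let ?I = "{0..enn2real (curve_length \<gamma> a b)}"
  have "arclength_param \<gamma> a b \<in> borel_measurable (restrict_space borel ?I)"
    using arclength_param_lipschitz[OF \<gamma>(1)]
    by (intro borel_measurable_continuous_on_restrict lipschitz_on_continuous_on)
  then have "arclength_param \<gamma> a b \<in> measurable (restrict_space borel ?I) (restrict_space borel Y)"
    using arclength_param_in[OF \<gamma>(1)] \<gamma>(2)
    by (intro measurable_restrict_space2) (auto simp: space_restrict_space)
  from measurable_comp[OF this g] show ?thesis
    using borel_measurable_restrict_space_iff_ennreal[of ?I borel "g \<circ> arclength_param \<gamma> a b"]
    by (simp add: comp_def)
qed

text \<open>The arc-length parametrization of the subcurve is that of the whole curve shifted by the
  length up to \<open>a'\<close>, and Lebesgue measure is translation invariant.\<close>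

lemma line_integral_subcurve_le:
  assumes \<gamma>: "rectifiable_curve \<gamma> a b" "\<gamma> ` {a..b} \<subseteq> Y"
    and sub: "a \<le> a'" "a' \<le> b'" "b' \<le> b"
    and g: "g' \<in> borel_measurable (restrict_space borel Y)"
    and le: "\<And>t. t \<in> {a'..b'} \<Longrightarrow> g (\<gamma> t) \<le> g' (\<gamma> t)"
  shows "line_integral \<gamma> a' b' g \<le> line_integral \<gamma> a b g'"
proof -
  let ?L = "\<lambda>t. enn2real (curve_length \<gamma> a t)" and ?L' = "\<lambda>t. enn2real (curve_length \<gamma> a' t)"
  let ?F = "\<lambda>s. g' (arclength_param \<gamma> a b s) * indicator {0..?L b} s"
  have \<gamma>': "rectifiable_curve \<gamma> a' b'"
    using \<gamma>(1) sub curve_length_finite[OF \<gamma>(1), of a' b']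
    by (auto simp: rectifiable_curve_def elim: continuous_on_subset)
  have fin: "curve_length \<gamma> a b < \<infinity>" "curve_length \<gamma> a' b' < \<infinity>"
    using \<gamma>(1) \<gamma>' by (auto simp: rectifiable_curve_def)
  have "line_integral \<gamma> a' b' g \<le> (\<integral>\<^sup>+s. ?F (?L a' + 1 * s) \<partial>lborel)"
    unfolding line_integral_def
  proof (rule nn_integral_mono)
    fix s
    show "g (arclength_param \<gamma> a' b' s) * indicator {0..?L' b'} s \<le> ?F (?L a' + 1 * s)"
    proof (cases "s \<in> {0..?L' b'}")
      case True
      then obtain t where t: "t \<in> {a'..b'}" "?L' t = s" using arclength_surj[OF \<gamma>'] by blast
      have "?L t = ?L a' + s" using arclength_diff[OF \<gamma>(1), of a' t] t sub by auto
      moreover have "?L b = ?L t + enn2real (curve_length \<gamma> t b)"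
        using arclength_diff[OF \<gamma>(1), of t b] t sub by auto
      ultimately show ?thesis
        using arclength_param_curve_length[OF fin(1), of t] arclength_param_curve_length[OF fin(2), of t]
          t sub le[of t] True by (auto simp: indicator_def)
    qed auto
  qed
  also have "\<dots> = (\<integral>\<^sup>+s. ?F s \<partial>lborel)"
    using nn_integral_real_affine[of ?F 1 "?L a'"] measurable_comp_arclength_param[OF \<gamma> g] by simp
  finally show ?thesis by (simp add: line_integral_def)
qed

section \<open>Truncation of upper gradients\<close>

lemma upper_gradient_on_realD:
  assumes "upper_gradient_on Y (\<lambda>x. ereal (v x)) g" "rectifiable_curve \<gamma> a b" "\<gamma> ` {a..b} \<subseteq> Y"
  shows "ennreal \<bar>v (\<gamma> a) - v (\<gamma> b)\<bar> \<le> line_integral \<gamma> a b g"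
proof -
  have "if \<bar>ereal (v (\<gamma> a))\<bar> \<noteq> \<infinity> \<and> \<bar>ereal (v (\<gamma> b))\<bar> \<noteq> \<infinity>
    then e2ennreal \<bar>ereal (v (\<gamma> a)) - ereal (v (\<gamma> b))\<bar> \<le> line_integral \<gamma> a b g
    else line_integral \<gamma> a b g = \<infinity>"
    using assms unfolding upper_gradient_on_def by blast
  then show ?thesis by (simp add: ereal_minus(1) abs_ereal.simps e2ennreal_ereal)
qed

text \<open>\<open>b'\<close> is the first time at which \<open>f\<close> reaches \<open>q\<close>,
  and \<open>a'\<close> the last time before \<open>b'\<close> at which \<open>f\<close> is at most
  \<open>p\<close>; in between neither level can be passed.\<close>

lemma crossing_subinterval:
  fixes f :: "real \<Rightarrow> real"
  assumes f: "continuous_on {a..b} f" and ab: "a \<le> b" "f a \<le> p" "p < q" "q \<le> f b"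
  shows "\<exists>a' b'. a \<le> a' \<and> a' \<le> b' \<and> b' \<le> b \<and> f a' = p \<and> f b' = q \<and> (\<forall>s\<in>{a'..b'}. p \<le> f s \<and> f s \<le> q)"
proof -
  let ?B = "{s \<in> {a..b}. f s \<in> {q..}}"
  have "?B = {a..b} \<inter> ({a..b} \<inter> f -` {q..})" by auto
  then have "compact ?B"
    using f by (metis closed_atLeastAtMost closed_atLeast compact_Icc compact_Int_closed continuous_closed_preimage)
  moreover have "b \<in> ?B" using ab by auto
  ultimately obtain b' where b': "b' \<in> ?B" "\<And>s. s \<in> ?B \<Longrightarrow> b' \<le> s"
    using compact_attains_inf[of ?B] by blast
  let ?A = "{s \<in> {a..b'}. f s \<in> {..p}}"
  have fb': "continuous_on {a..b'} f" using f b' by (auto elim: continuous_on_subset)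
  have "f b' = q"
  proof -
    obtain s where "a \<le> s" "s \<le> b'" "f s = q"
      using IVT'[of f a q b'] fb' b' ab by auto
    then show ?thesis using b' by (metis (mono_tags, lifting) atLeastAtMost_iff atLeast_iff mem_Collect_eq nle_le order_trans)
  qed
  have "?A = {a..b'} \<inter> ({a..b'} \<inter> f -` {..p})" by auto
  then have "compact ?A"
    using fb' by (metis closed_atLeastAtMost closed_atMost compact_Icc compact_Int_closed continuous_closed_preimage)
  moreover have "a \<in> ?A" using ab b' by auto
  ultimately obtain a' where a': "a' \<in> ?A" "\<And>s. s \<in> ?A \<Longrightarrow> s \<le> a'"
    using compact_attains_sup[of ?A] by blast
  have "continuous_on {a'..b'} f" using fb' a' by (auto elim: continuous_on_subset)
  then obtain s where "a' \<le> s" "s \<le> b'" "f s = p"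
    using IVT'[of f a' p b'] a' b' ab by auto
  then have "f a' = p" using a' by (metis (mono_tags, lifting) atLeastAtMost_iff atMost_iff mem_Collect_eq nle_le order_trans)
  show ?thesis
  proof (intro exI conjI ballI)
    show "a \<le> a'" "a' \<le> b'" "b' \<le> b" "f a' = p" "f b' = q"
      using a' b' \<open>f a' = p\<close> \<open>f b' = q\<close> by auto
    fix s assume s: "s \<in> {a'..b'}"
    have "p \<le> f s"
    proof (rule ccontr)
      assume "\<not> p \<le> f s"
      then have "s \<in> ?A" using s a' by auto
      then have "s = a'" using a' s by fastforce
      then show False using \<open>\<not> p \<le> f s\<close> \<open>f a' = p\<close> by simp
    qed
    moreover have "f s \<le> q"
    proof (rule ccontr)
      assume "\<not> f s \<le> q"
      then have "s \<in> ?B" using s a' b' by auto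
      then have "s = b'" using b' s by fastforce
      then show False using \<open>\<not> f s \<le> q\<close> \<open>f b' = q\<close> by simp
    qed
    ultimately show "p \<le> f s" "f s \<le> q" by simp_all
  qed
qed

text \<open>The change of the clamped function is realised by \<open>f\<close> itself on a
  subinterval where the clamp is inactive. A decreasing crossing becomes an increasing one for
  \<open>- f\<close> and the band from \<open>- t - h\<close> to \<open>- t\<close>, which is why
  \<open>up\<close> is stated for arbitrary \<open>t\<close> and \<open>k\<close>.\<close>

lemma clamp_crossing_subinterval:
  fixes f :: "real \<Rightarrow> real"
  defines "c \<equiv> \<lambda>t h z. max t (min (t + h) z)"
  assumes f: "continuous_on {a..b} f" and ab: "a \<le> b" and h: "h > 0" and ne: "c t h (f a) \<noteq> c t h (f b)"
  shows "\<exists>a' b'. a \<le> a' \<and> a' \<le> b' \<and> b' \<le> b \<and> \<bar>f a' - f b'\<bar> = \<bar>c t h (f a) - c t h (f b)\<bar> \<and>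
           (\<forall>s\<in>{a'..b'}. t \<le> f s \<and> f s \<le> t + h)"
proof -
  have up: "\<exists>a' b'. a \<le> a' \<and> a' \<le> b' \<and> b' \<le> b \<and> \<bar>k a' - k b'\<bar> = \<bar>c t h (k a) - c t h (k b)\<bar> \<and>
           (\<forall>s\<in>{a'..b'}. t \<le> k s \<and> k s \<le> t + h)"
    if k: "continuous_on {a..b} k" and lt: "c t h (k a) < c t h (k b)" for t and k :: "real \<Rightarrow> real"
  proof -
    have "k a \<le> c t h (k a)" "c t h (k b) \<le> k b" and bd: "t \<le> c t h (k a)" "c t h (k b) \<le> t + h"
      using lt h by (auto simp: c_def max_def min_def split: if_splits)
    from crossing_subinterval[OF k ab this(1) lt this(2)] obtain a' b' where
      "a \<le> a' \<and> a' \<le> b' \<and> b' \<le> b \<and> k a' = c t h (k a) \<and> k b' = c t h (k b)"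
      and s: "\<forall>s\<in>{a'..b'}. c t h (k a) \<le> k s \<and> k s \<le> c t h (k b)"
      by blast
    then show ?thesis
      using bd by (intro exI[of _ a'] exI[of _ b']) (simp, meson order_trans)
  qed
  show ?thesis
  proof (cases "c t h (f a) < c t h (f b)")
    case False
    have neg: "c (- t - h) h (- z) = - c t h z" for z
      using h by (auto simp: c_def max_def min_def)
    from False ne have "c (- t - h) h (- f a) < c (- t - h) h (- f b)" by (simp add: neg)
    from up[OF continuous_on_minus[OF f] this] obtain a' b' where
      *: "a \<le> a' \<and> a' \<le> b' \<and> b' \<le> b \<and> \<bar>- f a' - - f b'\<bar> = \<bar>c (- t - h) h (- f a) - c (- t - h) h (- f b)\<bar>"
      and s: "\<forall>s\<in>{a'..b'}. - t - h \<le> - f s \<and> - f s \<le> - t - h + h" by blast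
    from * have "\<bar>f a' - f b'\<bar> = \<bar>c t h (f a) - c t h (f b)\<bar>"
      unfolding neg by linarith
    moreover have "\<forall>s\<in>{a'..b'}. t \<le> f s \<and> f s \<le> t + h" using s by force
    ultimately show ?thesis using * by (intro exI[of _ a'] exI[of _ b']) simp
  qed (rule up[OF f])
qed

definition level_ramp :: "real \<Rightarrow> real \<Rightarrow> real \<Rightarrow> real" where
  "level_ramp t h z = max 0 (min 1 ((z - t) / h))"

lemma level_ramp_bounds: "0 \<le> level_ramp t h z" "level_ramp t h z \<le> 1"
  by (auto simp: level_ramp_def)

lemma level_ramp_altdef: "h > 0 \<Longrightarrow> level_ramp t h z = (max t (min (t + h) z) - t) / h"
  by (auto simp: level_ramp_def max_def min_def field_simps)

text \<open>A curve may enter and leave the band many times, but by the crossing lemma one subcurve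
  inside the band already carries the full change of the ramp. There \<open>g\<close> agrees with
  its cutoff, and the reverse triangle inequality passes from |v| to \<open>v\<close>.\<close>

lemma upper_gradient_on_level_ramp:
  fixes v :: "'a::metric_space \<Rightarrow> real"
  assumes v: "upper_gradient_on Y (\<lambda>x. ereal (v x)) g" "continuous_on Y v" and h: "h > 0"
  shows "upper_gradient_on Y (\<lambda>x. ereal (level_ramp t h \<bar>v x\<bar>))
           (\<lambda>x. g x * (ennreal (1 / h) * indicator {t..t + h} \<bar>v x\<bar>))"
proof -
  let ?g = "\<lambda>x. g x * (ennreal (1 / h) * indicator {t..t + h} \<bar>v x\<bar>)"
  let ?g' = "\<lambda>x. g x * indicator {t..t + h} \<bar>v x\<bar>"
  have [measurable]: "g \<in> borel_measurable (restrict_space borel Y)"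
    using v(1) by (simp add: upper_gradient_on_def)
  have [measurable]: "v \<in> borel_measurable (restrict_space borel Y)"
    using v(2) by (rule borel_measurable_continuous_on_restrict)
  have g: "?g \<in> borel_measurable (restrict_space borel Y)" by measurable
  have g': "?g' \<in> borel_measurable (restrict_space borel Y)" by measurable
  have key: "ennreal \<bar>level_ramp t h \<bar>v (\<gamma> a)\<bar> - level_ramp t h \<bar>v (\<gamma> b)\<bar>\<bar> \<le> line_integral \<gamma> a b ?g"
    if \<gamma>: "rectifiable_curve \<gamma> a b" "\<gamma> ` {a..b} \<subseteq> Y" for \<gamma> a b
  proof -
    define f where "f = (\<lambda>s. \<bar>v (\<gamma> s)\<bar>)"
    let ?c = "\<lambda>z. max t (min (t + h) z)"
    have ab: "a \<le> b" and c\<gamma>: "continuous_on {a..b} \<gamma>" using \<gamma>(1) by (auto simp: rectifiable_curve_def)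
    have f: "continuous_on {a..b} f" unfolding f_def
      by (rule continuous_on_rabs, rule continuous_on_compose2[OF v(2) c\<gamma> \<gamma>(2)])
    show ?thesis
    proof (cases "?c (f a) = ?c (f b)")
      case True
      then show ?thesis unfolding f_def level_ramp_altdef[OF h] by simp
    next
      case False
      from clamp_crossing_subinterval[OF f ab h this]
      obtain a' b' where ab': "a \<le> a'" "a' \<le> b'" "b' \<le> b"
        and eq: "\<bar>f a' - f b'\<bar> = \<bar>?c (f a) - ?c (f b)\<bar>"
        and rng: "\<forall>s\<in>{a'..b'}. t \<le> f s \<and> f s \<le> t + h"
        by blast
      have "continuous_on {a'..b'} \<gamma>" using ab' by (intro continuous_on_subset[OF c\<gamma>]) auto
      then have "rectifiable_curve \<gamma> a' b'"
        using ab' curve_length_finite[OF \<gamma>(1) ab'] by (simp add: rectifiable_curve_def)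
      moreover have "\<gamma> ` {a'..b'} \<subseteq> Y" using \<gamma>(2) ab' by (auto simp: image_subset_iff)
      ultimately have *: "ennreal \<bar>v (\<gamma> a') - v (\<gamma> b')\<bar> \<le> line_integral \<gamma> a' b' g"
        by (rule upper_gradient_on_realD[OF v(1)])
      have "\<bar>level_ramp t h (f a) - level_ramp t h (f b)\<bar> = 1 / h * \<bar>f a' - f b'\<bar>"
        unfolding eq level_ramp_altdef[OF h] diff_divide_distrib[symmetric] using h by simp
      then have "ennreal \<bar>level_ramp t h (f a) - level_ramp t h (f b)\<bar> = ennreal (1 / h) * ennreal \<bar>f a' - f b'\<bar>"
        using h by (simp only: ennreal_mult[symmetric] abs_ge_zero zero_le_divide_1_iff less_imp_le)
      also have "\<dots> \<le> ennreal (1 / h) * ennreal \<bar>v (\<gamma> a') - v (\<gamma> b')\<bar>"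
        unfolding f_def by (intro mult_left_mono ennreal_leI) auto
      also have "\<dots> \<le> ennreal (1 / h) * line_integral \<gamma> a' b' g"
        by (intro mult_left_mono *) auto
      also have "\<dots> \<le> ennreal (1 / h) * line_integral \<gamma> a b ?g'"
        using rng by (intro mult_left_mono line_integral_subcurve_le[OF \<gamma> ab' g']) (auto simp: f_def)
      also have "\<dots> = line_integral \<gamma> a b ?g"
        unfolding line_integral_def
        using measurable_comp_arclength_param[OF \<gamma> g']
        by (subst nn_integral_cmult[symmetric]) (simp_all add: mult_ac)
      finally show ?thesis by (simp add: f_def)
    qed
  qed
  show ?thesis
    unfolding upper_gradient_on_def
  proof (intro conjI allI impI)
    fix \<gamma> a b assume "rectifiable_curve \<gamma> a b \<and> \<gamma> ` {a..b} \<subseteq> Y"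
    with key[of \<gamma> a b] show "if \<bar>ereal (level_ramp t h \<bar>v (\<gamma> a)\<bar>)\<bar> \<noteq> \<infinity> \<and> \<bar>ereal (level_ramp t h \<bar>v (\<gamma> b)\<bar>)\<bar> \<noteq> \<infinity>
       then e2ennreal \<bar>ereal (level_ramp t h \<bar>v (\<gamma> a)\<bar>) - ereal (level_ramp t h \<bar>v (\<gamma> b)\<bar>)\<bar> \<le> line_integral \<gamma> a b ?g
       else line_integral \<gamma> a b ?g = \<infinity>"
      by (simp add: e2ennreal_ereal)
  qed (rule g)
qed

section \<open>The codimension one Hausdorff measure is an outer measure\<close>

lemma infsum_ennreal_eq_suminf:
  fixes f :: "nat \<Rightarrow> ennreal"
  shows "infsum f I = (\<Sum>i. if i \<in> I then f i else 0)"
proof -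
  have "infsum f I = infsum (\<lambda>i. if i \<in> I then f i else 0) UNIV"
    by (rule infsum_cong_neutral) auto
  moreover have "((\<lambda>i. if i \<in> I then f i else 0) has_sum infsum (\<lambda>i. if i \<in> I then f i else 0) UNIV) UNIV"
    by (intro has_sum_infsum nonneg_summable_on_complete) auto
  ultimately show ?thesis
    using sums_unique[OF has_sum_imp_sums] by simp
qed

lemma codim1_content_mono: "A \<subseteq> B \<Longrightarrow> codim1_content \<mu> R A \<le> codim1_content \<mu> R B"
  unfolding codim1_content_def by (rule Inf_superset_mono) blast

lemma codim1_content_empty: "codim1_content \<mu> R {} = 0"
proof -
  have "codim1_content \<mu> R {} \<le> (\<Sum>\<^sub>\<infinity>i\<in>({} :: nat set). \<mu> (ball undefined 0) / ennreal 0)"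
    unfolding codim1_content_def by (rule Inf_lower) force
  then show ?thesis by simp
qed

text \<open>Covers with excess \<open>e / 2 ^ (n + 1)\<close> are merged through
  \<open>prod_decode\<close>. The radius bound \<open>R\<close> is the same for all of them, so
  subadditivity already holds at each fixed scale.\<close>

lemma codim1_content_UN_le:
  "codim1_content \<mu> R (\<Union>n. A n) \<le> (\<Sum>n. codim1_content \<mu> R (A n))"
proof (rule ennreal_le_epsilon)
  fix e :: real assume e: "0 < e" and top: "(\<Sum>n. codim1_content \<mu> R (A n)) < top"
  let ?S = "\<lambda>I x r i. if i \<in> I then \<mu> (ball (x i) (r i)) / ennreal (r i) else 0"
  have "\<exists>I x r. A n \<subseteq> (\<Union>i\<in>I. ball (x i) (r i)) \<and> (\<forall>i\<in>(I :: nat set). 0 < r i \<and> r i \<le> R) \<and>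
          (\<Sum>i. ?S I x r i) \<le> codim1_content \<mu> R (A n) + ennreal (e * (1 / 2) ^ Suc n)" for n
  proof -
    have "codim1_content \<mu> R (A n) < top"
      using top ennreal_suminf_lessD by blast
    then have "codim1_content \<mu> R (A n) < codim1_content \<mu> R (A n) + ennreal (e * (1 / 2) ^ Suc n)"
      using e by (cases "codim1_content \<mu> R (A n)") (simp_all flip: ennreal_plus add: ennreal_less_iff)
    then obtain I x r where "A n \<subseteq> (\<Union>i\<in>I. ball (x i) (r i)) \<and> (\<forall>i\<in>(I :: nat set). 0 < r i \<and> r i \<le> R)"
      "(\<Sum>\<^sub>\<infinity>i\<in>I. \<mu> (ball (x i) (r i)) / ennreal (r i)) < codim1_content \<mu> R (A n) + ennreal (e * (1 / 2) ^ Suc n)"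
      unfolding codim1_content_def Inf_less_iff by blast
    then show ?thesis
      unfolding infsum_ennreal_eq_suminf by (intro exI[of _ I] exI[of _ x] exI[of _ r]) simp
  qed
  then have "\<forall>n. \<exists>I x r. A n \<subseteq> (\<Union>i\<in>I. ball (x i) (r i)) \<and> (\<forall>i\<in>(I :: nat set). 0 < r i \<and> r i \<le> R) \<and>
          (\<Sum>i. ?S I x r i) \<le> codim1_content \<mu> R (A n) + ennreal (e * (1 / 2) ^ Suc n)"
    by (rule allI)
  then have "\<exists>I x r. \<forall>n. A n \<subseteq> (\<Union>i\<in>I n. ball (x n i) (r n i)) \<and> (\<forall>i\<in>(I n :: nat set). 0 < r n i \<and> r n i \<le> R) \<and>
          (\<Sum>i. ?S (I n) (x n) (r n) i) \<le> codim1_content \<mu> R (A n) + ennreal (e * (1 / 2) ^ Suc n)"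
    by (simp only: choice_iff)
  then obtain I x r where cov: "\<And>n. A n \<subseteq> (\<Union>i\<in>I n. ball (x n i) (r n i))"
    and rad: "\<And>n i. i \<in> (I n :: nat set) \<Longrightarrow> 0 < r n i \<and> r n i \<le> R"
    and sum: "\<And>n. (\<Sum>i. ?S (I n) (x n) (r n) i) \<le> codim1_content \<mu> R (A n) + ennreal (e * (1 / 2) ^ Suc n)"
    by blast
  define J where "J = {k. snd (prod_decode k) \<in> I (fst (prod_decode k))}"
  define y where "y = (\<lambda>k. x (fst (prod_decode k)) (snd (prod_decode k)))"
  define s where "s = (\<lambda>k. r (fst (prod_decode k)) (snd (prod_decode k)))"
  have "(\<Union>n. A n) \<subseteq> (\<Union>k\<in>J. ball (y k) (s k))"
  proof
    fix p assume "p \<in> (\<Union>n. A n)"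
    then obtain n i where "i \<in> I n" "p \<in> ball (x n i) (r n i)" using cov by blast
    then show "p \<in> (\<Union>k\<in>J. ball (y k) (s k))"
      by (intro UN_I[of "prod_encode (n, i)"]) (auto simp: J_def y_def s_def)
  qed
  moreover have "\<forall>k\<in>J. 0 < s k \<and> s k \<le> R" using rad by (auto simp: J_def s_def)
  ultimately have "codim1_content \<mu> R (\<Union>n. A n) \<le> (\<Sum>\<^sub>\<infinity>k\<in>J. \<mu> (ball (y k) (s k)) / ennreal (s k))"
    unfolding codim1_content_def by (intro Inf_lower) blast
  also have "\<dots> = (\<Sum>k. (\<lambda>(n, i). ?S (I n) (x n) (r n) i) (prod_decode k))"
    unfolding infsum_ennreal_eq_suminf
    by (intro suminf_cong) (auto simp: J_def y_def s_def split: prod.split)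
  also have "\<dots> = (\<Sum>n. \<Sum>i. ?S (I n) (x n) (r n) i)"
    by (rule suminf_ennreal_2dimen) simp
  also have "\<dots> \<le> (\<Sum>n. codim1_content \<mu> R (A n) + ennreal (e * (1 / 2) ^ Suc n))"
    by (intro suminf_le sum) auto
  also have "\<dots> = (\<Sum>n. codim1_content \<mu> R (A n)) + (\<Sum>n. ennreal (e * (1 / 2) ^ Suc n))"
    by (rule suminf_add[symmetric]) auto
  also have "(\<Sum>n. ennreal (e * (1 / 2) ^ Suc n)) = ennreal e"
    using e sums_mult[OF power_half_series, of e] by (intro suminf_ennreal_eq) auto
  finally show "codim1_content \<mu> R (\<Union>n. A n) \<le> (\<Sum>n. codim1_content \<mu> R (A n)) + ennreal e" .
qed

lemma codim1_content_le_hausdorff: "R > 0 \<Longrightarrow> codim1_content \<mu> R A \<le> codim1_hausdorff \<mu> A"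
  unfolding codim1_hausdorff_eq_SUP by (rule SUP_upper) simp

lemma codim1_hausdorff_mono: "A \<subseteq> B \<Longrightarrow> codim1_hausdorff \<mu> A \<le> codim1_hausdorff \<mu> B"
  unfolding codim1_hausdorff_eq_SUP by (intro SUP_mono) (auto intro: codim1_content_mono)

lemma codim1_hausdorff_empty [simp]: "codim1_hausdorff \<mu> {} = 0"
  by (simp add: codim1_hausdorff_eq_SUP codim1_content_empty)

lemma codim1_hausdorff_UN_le: "codim1_hausdorff \<mu> (\<Union>n. A n) \<le> (\<Sum>n. codim1_hausdorff \<mu> (A n))"
  unfolding codim1_hausdorff_eq_SUP[of \<mu> "\<Union>n. A n"]
proof (rule SUP_least)
  fix R :: real assume "R \<in> {0<..}"
  then have "(\<Sum>n. codim1_content \<mu> R (A n)) \<le> (\<Sum>n. codim1_hausdorff \<mu> (A n))"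
    by (intro suminf_le codim1_content_le_hausdorff) auto
  with codim1_content_UN_le show "codim1_content \<mu> R (\<Union>n. A n) \<le> (\<Sum>n. codim1_hausdorff \<mu> (A n))"
    by (rule order_trans)
qed

text \<open>The sum is written as an integral over the counting measure, so that Fatou's lemma can
  be applied to it in \<open>switching_set_estimate\<close>.\<close>

lemma codim1_hausdorff_countable_UN_le:
  assumes "countable I"
  shows "codim1_hausdorff \<mu> (\<Union>i\<in>I. A i) \<le> (\<integral>\<^sup>+i. codim1_hausdorff \<mu> (A i) \<partial>count_space I)"
proof -
  let ?f = "to_nat_on I"
  let ?B = "\<lambda>n. if n \<in> ?f ` I then A (from_nat_into I n) else {}"
  have "(\<Union>i\<in>I. A i) \<subseteq> (\<Union>n. ?B n)"
    using assms by force
  then have "codim1_hausdorff \<mu> (\<Union>i\<in>I. A i) \<le> (\<Sum>n. codim1_hausdorff \<mu> (?B n))"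
    by (rule order_trans[OF codim1_hausdorff_mono codim1_hausdorff_UN_le])
  also have "\<dots> = (\<integral>\<^sup>+n. codim1_hausdorff \<mu> (?B n) \<partial>count_space UNIV)"
    by (simp add: nn_integral_count_space_nat)
  also have "\<dots> = (\<integral>\<^sup>+n. codim1_hausdorff \<mu> (?B n) * indicator (?f ` I) n \<partial>count_space UNIV)"
    by (intro nn_integral_cong) auto
  also have "\<dots> = (\<integral>\<^sup>+n. codim1_hausdorff \<mu> (?B n) \<partial>count_space (?f ` I))"
    by (simp add: nn_integral_count_space_indicator)
  also have "\<dots> = (\<integral>\<^sup>+i. codim1_hausdorff \<mu> (?B (?f i)) \<partial>count_space I)"
    using assms by (intro nn_integral_bij_count_space[symmetric]) (simp add: inj_on_imp_bij_betw inj_on_to_nat_on)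
  also have "\<dots> = (\<integral>\<^sup>+i. codim1_hausdorff \<mu> (A i) \<partial>count_space I)"
    using assms by (intro nn_integral_cong) auto
  finally show ?thesis .
qed

lemma codim1_hausdorff_Un_le: "codim1_hausdorff \<mu> (A \<union> B) \<le> codim1_hausdorff \<mu> A + codim1_hausdorff \<mu> B"
proof -
  have "codim1_hausdorff \<mu> (A \<union> B) \<le> (\<Sum>n. codim1_hausdorff \<mu> (binaryset A B n))"
    using codim1_hausdorff_UN_le[of \<mu> "binaryset A B"] by (simp add: UN_binaryset_eq)
  also have "\<dots> = codim1_hausdorff \<mu> A + codim1_hausdorff \<mu> B"
    by (simp add: suminf_binaryset_eq)
  finally show ?thesis .
qed

lemma outer_measure_space_codim1_hausdorff: "outer_measure_space (Pow UNIV) (codim1_hausdorff \<mu>)"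
  unfolding outer_measure_space_def positive_def increasing_def countably_subadditive_def
  by (simp add: codim1_hausdorff_mono codim1_hausdorff_UN_le)

section \<open>Doubling measures\<close>

locale doubling_measure =
  fixes \<mu> :: "'a::metric_space set \<Rightarrow> ennreal" and C :: real
  assumes regular: "borel_regular_outer_measure \<mu>" and dbl: "doubling \<mu> C"
begin

abbreviation "M \<equiv> caratheodory_measure \<mu>"

lemma outer: "outer_measure_space (Pow UNIV) \<mu>"
  using regular by (simp add: borel_regular_outer_measure_def)

lemma space_M [simp]: "space M = UNIV"
  by (simp add: caratheodory_measure_def space_measure_of_conv)

lemma borel_sets_M: "A \<in> sets borel \<Longrightarrow> A \<in> sets M"
  using regular by (auto simp: borel_regular_outer_measure_def sets_caratheodory_measure[OF outer])

lemma ball_sets_M [measurable, simp]: "ball x r \<in> sets M"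
  by (rule borel_sets_M) simp

lemma emeasure_M: "A \<in> sets M \<Longrightarrow> emeasure M A = \<mu> A"
  by (simp add: sets_caratheodory_measure[OF outer] emeasure_caratheodory_measure[OF outer])

lemma mu_mono: "A \<subseteq> B \<Longrightarrow> \<mu> A \<le> \<mu> B"
  using outer by (simp add: outer_measure_space_def increasing_def)

lemma C_pos: "C > 0"
  using dbl by (simp add: doubling_def)

lemma doubling_ball: "r > 0 \<Longrightarrow> \<mu> (ball x (2 * r)) \<le> ennreal C * \<mu> (ball x r)"
  using dbl by (simp add: doubling_def)

lemma ball_pos: "r > 0 \<Longrightarrow> 0 < \<mu> (ball x r)"
  using dbl[unfolded doubling_def, THEN conjunct2, rule_format, of "r / 2" x] by simp

lemma ball_finite: "\<mu> (ball x r) < \<infinity>"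
proof (cases "r > 0")
  case True
  then have "ennreal C * \<mu> (ball x r) < \<infinity>" using dbl by (simp add: doubling_def)
  then show ?thesis using C_pos by (auto simp: ennreal_mult_less_top)
next
  case False
  then have "\<mu> (ball x r) \<le> \<mu> (ball x 0)" by (intro mu_mono) auto
  moreover have "\<mu> {} = 0" using outer by (simp add: outer_measure_space_def positive_def)
  ultimately show ?thesis by simp
qed

lemma mu_bounded_finite:
  assumes "bounded A" shows "\<mu> A < \<infinity>"
proof -
  obtain R where "A \<subseteq> ball undefined R" using assms bounded_subset_ballD by blast
  then show ?thesis using ball_finite by (rule le_less_trans[OF mu_mono])
qed

text \<open>Iterated doubling up to a power of two above \<open>K\<close>; the normalisation
  \<open>D \<ge> 1\<close> permits division by \<open>D\<close> later.\<close>

lemma doubling_ball_scale: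
  obtains D where "D \<ge> 1" "\<And>x r. r > 0 \<Longrightarrow> \<mu> (ball x (K * r)) \<le> ennreal D * \<mu> (ball x r)"
proof -
  obtain n :: nat where n: "K < 2 ^ n"
    using real_arch_pow[of 2 K] by auto
  have "\<mu> (ball x (2 ^ k * r)) \<le> ennreal (C ^ k) * \<mu> (ball x r)" if "r > 0" for x r k
  proof (induction k)
    case (Suc k)
    have "\<mu> (ball x (2 ^ Suc k * r)) \<le> ennreal C * \<mu> (ball x (2 ^ k * r))"
      using doubling_ball[of "2 ^ k * r" x] that by (simp add: mult.assoc)
    also have "\<dots> \<le> ennreal C * (ennreal (C ^ k) * \<mu> (ball x r))"
      by (intro mult_left_mono Suc) simp
    also have "\<dots> = ennreal (C ^ Suc k) * \<mu> (ball x r)"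
      using C_pos by (simp add: ennreal_mult mult.assoc)
    finally show ?case .
  qed simp
  moreover have "\<mu> (ball x (K * r)) \<le> \<mu> (ball x (2 ^ n * r))" if "r > 0" for x r
    using n that by (intro mu_mono subset_ball) simp
  moreover have "ennreal (C ^ n) * m \<le> ennreal (max 1 (C ^ n)) * m" for m
    by (intro mult_right_mono ennreal_leI) auto
  ultimately have "\<mu> (ball x (K * r)) \<le> ennreal (max 1 (C ^ n)) * \<mu> (ball x r)" if "r > 0" for x r
    using that by (meson order_trans)
  then show thesis by (intro that[of "max 1 (C ^ n)"]) auto
qed

lemma sum_disjoint_balls_le:
  assumes "finite F" "pairwise (\<lambda>x y. disjnt (ball x (r x)) (ball y (r y))) F"
    and "\<And>x. x \<in> F \<Longrightarrow> ball x (r x) \<subseteq> B"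
  shows "(\<Sum>x\<in>F. \<mu> (ball x (r x))) \<le> \<mu> B"
proof -
  have "(\<Sum>x\<in>F. \<mu> (ball x (r x))) = (\<Sum>x\<in>F. emeasure M (ball x (r x)))"
    by (simp add: emeasure_M)
  also have "\<dots> = emeasure M (\<Union>x\<in>F. ball x (r x))"
    using assms by (intro sum_emeasure) (auto simp: disjoint_family_on_def pairwise_def disjnt_def)
  also have "\<dots> = \<mu> (\<Union>x\<in>F. ball x (r x))"
    using assms by (intro emeasure_M sets.finite_UN) auto
  also have "\<dots> \<le> \<mu> B" using assms by (intro mu_mono) auto
  finally show ?thesis .
qed

text \<open>Disjoint balls in a bounded set have summable masses, every mass is positive, and a
  summable family has countable support.\<close>

lemma countable_disjoint_balls:
  fixes r :: "'a \<Rightarrow> real"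
  assumes "pairwise (\<lambda>x y. disjnt (ball x (r x)) (ball y (r y))) S" "\<And>x. x \<in> S \<Longrightarrow> r x > 0"
    and "\<And>x. x \<in> S \<Longrightarrow> ball x (r x) \<subseteq> B" "bounded B"
  shows "countable S"
proof -
  let ?f = "\<lambda>x. enn2real (\<mu> (ball x (r x)))"
  have f: "ennreal (?f x) = \<mu> (ball x (r x))" for x
    using ball_finite by simp
  have "sum ?f F \<le> enn2real (\<mu> B)" if F: "finite F" "F \<subseteq> S" for F
  proof -
    have "ennreal (sum ?f F) = (\<Sum>x\<in>F. \<mu> (ball x (r x)))"
      by (subst sum_ennreal[symmetric]) (auto simp: f)
    also have "\<dots> \<le> \<mu> B"
      using F assms by (intro sum_disjoint_balls_le) (auto intro: pairwise_subset)
    also have "\<dots> = ennreal (enn2real (\<mu> B))"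
      using mu_bounded_finite[OF assms(4)] by simp
    finally show ?thesis by (subst (asm) ennreal_le_iff) auto
  qed
  then have "?f summable_on S"
    by (intro nonneg_bdd_above_summable_on bdd_aboveI[of _ "enn2real (\<mu> B)"]) auto
  then have "countable {x \<in> S. ?f x \<noteq> 0}"
    by (rule summable_countable_real)
  moreover have "?f x \<noteq> 0" if "x \<in> S" for x
    using ball_pos[OF assms(2)[OF that], of x] f[of x] by (metis ennreal_0 less_irrefl)
  then have "{x \<in> S. ?f x \<noteq> 0} = S" by auto
  ultimately show ?thesis by simp
qed

text \<open>Points with mutual distances at least \<open>e\<close> carry disjoint balls of radius
  \<open>e / 2\<close>, each with at least the share \<open>1 / D\<close> of a fixed large ball, so
  their number is bounded. A family of greatest cardinality is an \<open>e\<close>-net.\<close>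

lemma bounded_imp_totally_bounded:
  fixes S :: "'a set"
  assumes "bounded S" "e > 0"
  shows "\<exists>F. finite F \<and> S \<subseteq> (\<Union>x\<in>F. ball x e)"
proof -
  obtain p R where R: "S \<subseteq> ball p R" using assms(1) bounded_subset_ballD by blast
  define T where "T = max R 0 + e"
  have T: "T > 0" using assms(2) by (simp add: T_def)
  \<comment> \<open>The factor is chosen so that \<open>4 * T / e * (e / 2) = 2 * T\<close>, and the
    ball of radius \<open>2 * T\<close> about any point of \<open>S\<close> contains
    \<open>ball p T\<close>.\<close>
  obtain D where D: "D \<ge> 1" "\<And>x r. r > 0 \<Longrightarrow> \<mu> (ball x (4 * T / e * r)) \<le> ennreal D * \<mu> (ball x r)"
    using doubling_ball_scale[of "4 * T / e"] by blast
  let ?P = "\<lambda>F. finite F \<and> F \<subseteq> S \<and> pairwise (\<lambda>x y. e \<le> dist x y) F"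
  have card_le: "card F \<le> nat \<lceil>D\<rceil>" if "?P F" for F
  proof -
    have m: "\<mu> (ball p T) \<le> ennreal D * \<mu> (ball x (e / 2))" if "x \<in> F" for x
    proof -
      have "dist p x < R" using R \<open>?P F\<close> that by auto
      then have "dist x z < 2 * T" if "dist p z < T" for z
        using that dist_triangle[of x z p] \<open>e > 0\<close> by (simp add: T_def dist_commute)
      then have "ball p T \<subseteq> ball x (2 * T)" by auto
      then have "\<mu> (ball p T) \<le> \<mu> (ball x (2 * T))" by (rule mu_mono)
      also have "\<dots> \<le> ennreal D * \<mu> (ball x (e / 2))"
        using D(2)[of "e / 2" x] \<open>e > 0\<close> by simp
      finally show ?thesis .
    qed
    have "of_nat (card F) * \<mu> (ball p T) \<le> (\<Sum>x\<in>F. ennreal D * \<mu> (ball x (e / 2)))"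
      using sum_mono[of F "\<lambda>_. \<mu> (ball p T)" "\<lambda>x. ennreal D * \<mu> (ball x (e / 2))"] m by simp
    also have "\<dots> = ennreal D * (\<Sum>x\<in>F. \<mu> (ball x (e / 2)))" by (simp add: sum_distrib_left)
    also have "\<dots> \<le> ennreal D * \<mu> (ball p T)"
    proof (intro mult_left_mono sum_disjoint_balls_le)
      show "pairwise (\<lambda>x y. disjnt (ball x (e / 2)) (ball y (e / 2))) F"
      proof (rule pairwiseI)
        fix x y assume "x \<in> F" "y \<in> F" "x \<noteq> y"
        then have "e \<le> dist x y" using \<open>?P F\<close> by (auto simp: pairwise_def)
        then have "\<not> (dist x z < e / 2 \<and> dist y z < e / 2)" for z
          using dist_triangle2[of x y z] by linarith
        then show "disjnt (ball x (e / 2)) (ball y (e / 2))" by (auto simp: disjnt_def)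
      qed
      fix x assume "x \<in> F"
      then have "dist p x < R" using R \<open>?P F\<close> by auto
      then have "dist p z < T" if "dist x z < e / 2" for z
        using that dist_triangle[of p z x] \<open>e > 0\<close> by (simp add: T_def)
      then show "ball x (e / 2) \<subseteq> ball p T" by auto
    qed (use that in auto)
    finally have "of_nat (card F) * \<mu> (ball p T) \<le> ennreal D * \<mu> (ball p T)" .
    moreover obtain q where q: "\<mu> (ball p T) = ennreal q" "q > 0"
      using ball_finite[of p T] ball_pos[OF T, of p]
      by (cases "\<mu> (ball p T)") auto
    ultimately have "real (card F) * q \<le> D * q"
      using D(1) by (simp add: ennreal_of_nat_eq_real_of_nat flip: ennreal_mult)
    then have "real (card F) \<le> D" using q by simp
    then show ?thesis by linarith
  qed
  have "?P {}" by (simp add: pairwise_def)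
  moreover have "\<forall>F. ?P F \<longrightarrow> card F < Suc (nat \<lceil>D\<rceil>)"
    using card_le by (simp add: less_Suc_eq_le)
  ultimately have "\<exists>F. ?P F \<and> (\<forall>G. ?P G \<longrightarrow> card G \<le> card F)"
    by (rule ex_has_greatest_nat)
  then obtain F where F: "?P F" and max: "\<forall>G. ?P G \<longrightarrow> card G \<le> card F" by (elim exE conjE) simp
  have "S \<subseteq> (\<Union>x\<in>F. ball x e)"
  proof
    fix z assume z: "z \<in> S"
    show "z \<in> (\<Union>x\<in>F. ball x e)"
    proof (rule ccontr)
      assume far: "\<not> ?thesis"
      then have "z \<notin> F" using \<open>e > 0\<close> by auto
      have "?P (insert z F)"
        using F z far by (auto simp: pairwise_insert dist_commute not_less)
      with max have "card (insert z F) \<le> card F" by blast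
      then show False using F \<open>z \<notin> F\<close> by simp
    qed
  qed
  then show ?thesis using F by blast
qed

lemma bounded_complete_imp_compact:
  fixes S :: "'a set"
  assumes "bounded S" "complete S"
  shows "compact S"
  unfolding compact_eq_totally_bounded
  using assms(2) bounded_imp_totally_bounded[OF assms(1)] by simp

end

section \<open>A covering lemma\<close>

text \<open>Only the centres have to be covered, so the factor 3 suffices in place of the usual 5:
  if the ball of \<open>x\<close> meets that of \<open>y\<close> and
  \<open>r x \<le> 2 * r y\<close>, then \<open>dist y x < 3 * r y\<close>.\<close>

lemma vitali_covering_centers:
  fixes r :: "'a::metric_space \<Rightarrow> real"
  assumes r: "\<And>x. x \<in> A \<Longrightarrow> 0 < r x \<and> r x \<le> R"
  obtains S where "S \<subseteq> A" "pairwise (\<lambda>x y. disjnt (ball x (r x)) (ball y (r y))) S"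
    "A \<subseteq> (\<Union>x\<in>S. ball x (3 * r x))"
proof -
  let ?meet = "\<lambda>x y. \<not> disjnt (ball x (r x)) (ball y (r y))"
  \<comment> \<open>The class for Zorn's lemma: disjoint families such that every ball meeting the
    family meets a member of at least half its radius. This property survives unions of
    chains.\<close>
  define \<C> where "\<C> = {S. S \<subseteq> A \<and> pairwise (\<lambda>x y. \<not> ?meet x y) S \<and>
    (\<forall>x\<in>A. (\<exists>y\<in>S. ?meet x y) \<longrightarrow> (\<exists>y\<in>S. ?meet x y \<and> r x \<le> 2 * r y))}"
  have "\<exists>S\<in>\<C>. \<forall>X\<in>\<C>. S \<subseteq> X \<longrightarrow> X = S"
  proof (rule subset_Zorn')
    fix K assume K: "subset.chain \<C> K"
    then have sub: "K \<subseteq> \<C>" by (simp add: subset.chain_def)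
    have "pairwise (\<lambda>x y. \<not> ?meet x y) (\<Union>K)"
    proof (rule pairwiseI)
      fix x y assume "x \<in> \<Union>K" "y \<in> \<Union>K" "x \<noteq> y"
      then obtain S T where ST: "S \<in> K" "T \<in> K" "x \<in> S" "y \<in> T" by blast
      then have "S \<subseteq> T \<or> T \<subseteq> S" using K by (auto simp: subset.chain_def)
      then obtain U where "U \<in> K" "x \<in> U" "y \<in> U" using ST by blast
      moreover from this sub have "pairwise (\<lambda>x y. \<not> ?meet x y) U" by (auto simp: \<C>_def)
      ultimately show "\<not> ?meet x y" using \<open>x \<noteq> y\<close> unfolding pairwise_def by blast
    qed
    moreover have "\<exists>y\<in>\<Union>K. ?meet x y \<and> r x \<le> 2 * r y" if "x \<in> A" and ex: "\<exists>y\<in>\<Union>K. ?meet x y" for x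
    proof -
      obtain U where U: "U \<in> K" "\<exists>y\<in>U. ?meet x y" using ex by blast
      then have "\<exists>y\<in>U. ?meet x y \<and> r x \<le> 2 * r y"
        using sub \<open>x \<in> A\<close> unfolding \<C>_def by blast
      then show ?thesis using U by blast
    qed
    ultimately show "\<Union>K \<in> \<C>" using sub by (auto simp: \<C>_def)
  qed
  then obtain S where S: "S \<in> \<C>" and max: "\<And>X. X \<in> \<C> \<Longrightarrow> S \<subseteq> X \<Longrightarrow> X = S" by blast
  have SA: "S \<subseteq> A" and dis: "pairwise (\<lambda>x y. \<not> ?meet x y) S"
    and near: "\<And>x. x \<in> A \<Longrightarrow> \<exists>y\<in>S. ?meet x y \<Longrightarrow> \<exists>y\<in>S. ?meet x y \<and> r x \<le> 2 * r y"
    using S by (auto simp: \<C>_def)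
  have self: "?meet x x" if "x \<in> A" for x
    using r[OF that] by (auto simp: disjnt_def)
  have sym: "?meet x y \<longleftrightarrow> ?meet y x" for x y by (auto simp: disjnt_sym)
  have meets: "\<exists>y\<in>S. ?meet x y" if x: "x \<in> A" for x
  proof (rule ccontr)
    assume no: "\<not> ?thesis"
    \<comment> \<open>If some balls miss \<open>S\<close>, one of them with radius above half the
      supremum can be added: a ball that meets the enlarged family but not \<open>S\<close> has at
      most twice its radius. This contradicts maximality.\<close>
    define B where "B = {x\<in>A. \<not> (\<exists>y\<in>S. ?meet x y)}"
    have "x \<in> B" using x no by (simp add: B_def)
    have bdd: "bdd_above (r ` B)" using r by (auto simp: B_def intro!: bdd_aboveI[of _ R])
    let ?\<rho> = "Sup (r ` B)"
    have "0 < ?\<rho>" using r[OF x] cSup_upper[OF imageI[OF \<open>x \<in> B\<close>, of r] bdd] by linarith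
    then have "?\<rho> / 2 < ?\<rho>" by simp
    then obtain z where z: "z \<in> B" "?\<rho> / 2 < r z"
      using less_cSup_iff[OF _ bdd, of "?\<rho> / 2"] \<open>x \<in> B\<close> by auto
    have big: "r w \<le> 2 * r z" if "w \<in> B" for w
      using cSup_upper[OF imageI[OF that, of r] bdd] z by linarith
    have zA: "z \<in> A" and zS: "\<forall>y\<in>S. \<not> ?meet z y" using z by (auto simp: B_def)
    have "pairwise (\<lambda>x y. \<not> ?meet x y) (insert z S)"
      using dis zS by (auto simp: pairwise_insert sym[of _ z] disjnt_sym)
    moreover have "\<exists>y\<in>insert z S. ?meet w y \<and> r w \<le> 2 * r y"
      if "w \<in> A" "\<exists>y\<in>insert z S. ?meet w y" for w
    proof (cases "\<exists>y\<in>S. ?meet w y")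
      case True
      then show ?thesis using near[OF \<open>w \<in> A\<close>] by blast
    next
      case False
      then have "w \<in> B" using \<open>w \<in> A\<close> by (simp add: B_def)
      then show ?thesis using False that(2) big by blast
    qed
    ultimately have "insert z S \<in> \<C>" using SA zA by (auto simp: \<C>_def)
    then have "insert z S = S" by (rule max) auto
    then show False using zS self[OF zA] by blast
  qed
  have "A \<subseteq> (\<Union>x\<in>S. ball x (3 * r x))"
  proof
    fix x assume x: "x \<in> A"
    then obtain y where y: "y \<in> S" "?meet x y" "r x \<le> 2 * r y" using near meets by blast
    then obtain w where "dist x w < r x" "dist y w < r y" by (auto simp: disjnt_def)
    then have "dist y x < 3 * r y" using y(3) dist_triangle2[of y x w] by linarith
    then show "x \<in> (\<Union>x\<in>S. ball x (3 * r x))" using y(1) by auto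
  qed
  then show thesis using SA dis by (intro that) simp_all
qed

section \<open>Approximation of functions of bounded variation\<close>

locale doubling_domain = doubling_measure \<mu> C
  for \<mu> :: "'a::complete_space set \<Rightarrow> ennreal" and C :: real +
  fixes \<Omega> :: "'a set"
  assumes open_domain: "open \<Omega>" and bounded_domain: "bounded \<Omega>"
begin

abbreviation "N \<equiv> restrict_space M \<Omega>"

lemma domain_sets [measurable, simp]: "\<Omega> \<in> sets M"
  using open_domain by (intro borel_sets_M) simp

lemma space_N [simp]: "space N = \<Omega>"
  by (simp add: space_restrict_space)

lemma nn_integral_N: "(\<integral>\<^sup>+y. f y \<partial>N) = (\<integral>\<^sup>+y\<in>\<Omega>. f y \<partial>M)"
  by (rule nn_integral_restrict_space) simp

lemma sets_N_iff: "A \<in> sets N \<longleftrightarrow> A \<in> sets M \<and> A \<subseteq> \<Omega>"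
  by (subst sets_restrict_space_iff) auto

lemma emeasure_N: "A \<in> sets N \<Longrightarrow> emeasure N A = \<mu> A"
  by (subst emeasure_restrict_space) (auto simp: sets_N_iff emeasure_M)

sublocale N: finite_measure N
proof
  have "\<Omega> \<in> sets N" by (simp add: sets_N_iff)
  then show "emeasure N (space N) \<noteq> \<infinity>"
    using mu_bounded_finite[OF bounded_domain] by (simp add: emeasure_N)
qed

sublocale N_lborel: pair_sigma_finite N "lborel :: real measure" ..

lemma borel_measurable_N:
  assumes "f \<in> borel_measurable (restrict_space borel \<Omega>)"
  shows "f \<in> borel_measurable N"
proof -
  have "(\<lambda>x. x) \<in> measurable M borel"
    by (rule measurableI) (auto intro: borel_sets_M)
  then have "(\<lambda>x. x) \<in> measurable N (restrict_space borel \<Omega>)"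
    by (intro measurable_restrict_space3) auto
  from measurable_compose[OF this assms] show ?thesis .
qed

lemma ball_Int_sets_N [measurable, simp]: "ball x r \<inter> \<Omega> \<in> sets N" "\<Omega> \<inter> ball x r \<in> sets N"
  by (auto simp: sets_N_iff)

text \<open>Phrased by balls instead of the distance to the complement, which may be empty; the
  interior supplies the openness that \<open>compactly_inside\<close> demands.\<close>

definition exhaustion :: "nat \<Rightarrow> 'a set" where
  "exhaustion n = interior {y. ball y (inverse (Suc n)) \<subseteq> \<Omega>}"

text \<open>The points whose ball of the fixed radius lies in \<Omega> form a closed set, so taking
  the closure does not leave \<Omega>. Compactness comes from completeness together with the total
  boundedness that doubling provides.\<close>

lemma compactly_inside_exhaustion: "compactly_inside (exhaustion n) \<Omega>"
proof -
  let ?e = "inverse (real (Suc n))"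
  have "closed {y. ball y ?e \<subseteq> \<Omega>}"
    unfolding closed_sequential_limits
  proof (intro allI impI, elim conjE)
    fix x l assume x: "\<forall>k. x k \<in> {y. ball y ?e \<subseteq> \<Omega>}" and l: "x \<longlonglongrightarrow> l"
    have "z \<in> \<Omega>" if "z \<in> ball l ?e" for z
    proof -
      have "(\<lambda>k. dist (x k) z) \<longlonglongrightarrow> dist l z" using l by (intro tendsto_intros)
      moreover have "dist l z < ?e" using that by simp
      ultimately have "eventually (\<lambda>k. dist (x k) z < ?e) sequentially"
        by (rule order_tendstoD(2))
      then obtain k where "dist (x k) z < ?e" using eventually_happens' sequentially_bot by blast
      then have "z \<in> ball (x k) ?e" by simp
      then show ?thesis using x by blast
    qed
    then show "l \<in> {y. ball y ?e \<subseteq> \<Omega>}" by auto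
  qed
  then have cl: "closure (exhaustion n) \<subseteq> {y. ball y ?e \<subseteq> \<Omega>}"
    unfolding exhaustion_def by (rule closure_minimal[OF interior_subset])
  have sub: "{y. ball y ?e \<subseteq> \<Omega>} \<subseteq> \<Omega>"
  proof
    fix y assume "y \<in> {y. ball y ?e \<subseteq> \<Omega>}"
    moreover have "y \<in> ball y ?e" by (simp add: positive_imp_inverse_positive)
    ultimately show "y \<in> \<Omega>" by blast
  qed
  have cl\<Omega>: "closure (exhaustion n) \<subseteq> \<Omega>" using cl sub by (rule subset_trans)
  then have "bounded (closure (exhaustion n))" by (rule bounded_subset[OF bounded_domain])
  then have "compact (closure (exhaustion n))"
    by (intro bounded_complete_imp_compact) (simp_all add: complete_eq_closed)
  then show ?thesis
    using cl\<Omega> by (simp add: compactly_inside_def) (simp add: exhaustion_def)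
qed

lemma exhaustion_sets [measurable, simp]: "exhaustion n \<in> sets M"
  unfolding exhaustion_def by (intro borel_sets_M borel_open) simp

lemma exhaustion_subset: "exhaustion n \<subseteq> \<Omega>"
  using compactly_inside_exhaustion[of n] closure_subset[of "exhaustion n"]
  by (auto simp: compactly_inside_def)

lemma eventually_in_exhaustion:
  assumes "y \<in> \<Omega>"
  shows "eventually (\<lambda>n. y \<in> exhaustion n) sequentially"
proof -
  obtain e where e: "e > 0" "ball y e \<subseteq> \<Omega>" using open_domain assms by (auto simp: open_contains_ball)
  have "y \<in> exhaustion n" if n: "inverse (real (Suc n)) < e / 2" for n
    unfolding exhaustion_def
  proof (rule interiorI[of "ball y (e / 2)"])
    have "dist y w < e" if "dist y z < e / 2" "dist z w < inverse (real (Suc n))" for z w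
      using dist_triangle[of y w z] that n by linarith
    then show "ball y (e / 2) \<subseteq> {y. ball y (inverse (real (Suc n))) \<subseteq> \<Omega>}"
      using e(2) by auto
  qed (use e in auto)
  moreover have "eventually (\<lambda>n. inverse (real (Suc n)) < e / 2) sequentially"
    using e by (intro order_tendstoD[OF LIMSEQ_inverse_real_of_nat]) simp
  ultimately show ?thesis by (simp add: eventually_mono)
qed

lemma locally_lipschitz_continuous_on:
  assumes "locally_lipschitz_on \<Omega> v"
  shows "continuous_on \<Omega> v"
proof (rule continuous_at_imp_continuous_on, rule ballI)
  fix y assume "y \<in> \<Omega>"
  then obtain n where n: "y \<in> exhaustion n"
    using eventually_in_exhaustion eventually_happens' sequentially_bot by blast
  obtain L where "L-lipschitz_on (exhaustion n) v"
    using assms compactly_inside_exhaustion unfolding locally_lipschitz_on_def by blast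
  then have "continuous_on (exhaustion n) v" by (rule lipschitz_on_continuous_on)
  moreover have "open (exhaustion n)" by (simp add: exhaustion_def)
  ultimately show "isCont v y" using n by (simp add: continuous_on_eq_continuous_at)
qed

text \<open>A liminf below \<open>m\<close> makes infinitely many energies at most \<open>m\<close>,
  while the error on \<open>exhaustion n\<close> is eventually small, so for every \<open>n\<close>
  some index has both properties. Summable errors then give convergence almost everywhere, which for
  bounded functions of the approximations upgrades to L^1 convergence on the whole domain.\<close>

lemma total_variation_approximation:
  assumes u: "u \<in> borel_measurable N" and less: "total_variation \<mu> \<Omega> u < m"
  obtains v g where "\<And>n. continuous_on \<Omega> (v n)"
    "\<And>n::nat. upper_gradient_on \<Omega> (\<lambda>x. ereal (v n x)) (g n)"
    "\<And>n. (\<integral>\<^sup>+y. g n y \<partial>N) \<le> m"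
    "AE y in N. (\<lambda>n. v n y) \<longlonglongrightarrow> u y"
proof -
  from less obtain v g where v: "\<And>i::nat. locally_lipschitz_on \<Omega> (v i)"
    and g: "\<And>i. upper_gradient_on \<Omega> (\<lambda>x. ereal (v i x)) (g i)"
    and conv: "tendsto_L1_loc \<mu> \<Omega> v u"
    and lim: "liminf (\<lambda>i. \<integral>\<^sup>+y\<in>\<Omega>. g i y \<partial>M) < m"
    unfolding total_variation_def Inf_less_iff by auto
  have cont: "continuous_on \<Omega> (v i)" for i using v by (rule locally_lipschitz_continuous_on)
  then have vm [measurable]: "v i \<in> borel_measurable N" for i
    by (intro borel_measurable_N borel_measurable_continuous_on_restrict)
  have int_exh: "(\<integral>\<^sup>+y\<in>exhaustion n. f y \<partial>M) = (\<integral>\<^sup>+y. f y * indicator (exhaustion n) y \<partial>N)" for f n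
    unfolding nn_integral_N using exhaustion_subset[of n]
    by (intro nn_integral_cong) (auto simp: indicator_def)
  have "\<exists>i. (\<integral>\<^sup>+y. g i y \<partial>N) \<le> m \<and>
      (\<integral>\<^sup>+y. ennreal \<bar>v i y - u y\<bar> * indicator (exhaustion n) y \<partial>N) \<le> ennreal ((1 / 2) ^ Suc n)" for n
  proof -
    have "frequently (\<lambda>i. (\<integral>\<^sup>+y. g i y \<partial>N) < m) sequentially"
    proof (rule ccontr)
      assume "\<not> ?thesis"
      then have "eventually (\<lambda>i. m \<le> (\<integral>\<^sup>+y. g i y \<partial>N)) sequentially"
        by (simp add: not_frequently not_less)
      then have "m \<le> liminf (\<lambda>i. \<integral>\<^sup>+y. g i y \<partial>N)" by (rule Liminf_bounded)
      then show False using lim by (simp add: nn_integral_N)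
    qed
    moreover have "(\<lambda>i. \<integral>\<^sup>+y. ennreal \<bar>v i y - u y\<bar> * indicator (exhaustion n) y \<partial>N) \<longlonglongrightarrow> 0"
      using conv compactly_inside_exhaustion[of n] unfolding tendsto_L1_loc_def int_exh[symmetric] by blast
    then have "eventually (\<lambda>i. (\<integral>\<^sup>+y. ennreal \<bar>v i y - u y\<bar> * indicator (exhaustion n) y \<partial>N) < ennreal ((1 / 2) ^ Suc n)) sequentially"
      by (rule order_tendstoD(2)) simp
    ultimately have "frequently (\<lambda>i. (\<integral>\<^sup>+y. g i y \<partial>N) < m \<and>
      (\<integral>\<^sup>+y. ennreal \<bar>v i y - u y\<bar> * indicator (exhaustion n) y \<partial>N) < ennreal ((1 / 2) ^ Suc n)) sequentially"
      by (rule frequently_eventually_frequently)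
    then show ?thesis by (auto dest!: frequently_ex intro: less_imp_le)
  qed
  then obtain k where k: "\<And>n. (\<integral>\<^sup>+y. g (k n) y \<partial>N) \<le> m"
    and k': "\<And>n. (\<integral>\<^sup>+y. ennreal \<bar>v (k n) y - u y\<bar> * indicator (exhaustion n) y \<partial>N) \<le> ennreal ((1 / 2) ^ Suc n)"
    by metis
  have [measurable]: "indicator (exhaustion n) \<in> borel_measurable N" for n
    by (rule borel_measurable_indicator) (simp add: sets_N_iff exhaustion_subset)
  let ?f = "\<lambda>n y. ennreal \<bar>v (k n) y - u y\<bar> * indicator (exhaustion n) y"
  have fm [measurable]: "?f n \<in> borel_measurable N" for n using u by measurable
  have "(\<integral>\<^sup>+y. (\<Sum>n. ?f n y) \<partial>N) = (\<Sum>n. \<integral>\<^sup>+y. ?f n y \<partial>N)"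
    by (rule nn_integral_suminf) measurable
  also have "\<dots> \<le> (\<Sum>n. ennreal ((1 / 2) ^ Suc n))" by (intro suminf_le k') auto
  also have "\<dots> = ennreal 1" by (intro suminf_ennreal_eq power_half_series) simp
  finally have "(\<integral>\<^sup>+y. (\<Sum>n. ?f n y) \<partial>N) \<noteq> \<infinity>" by (auto simp: top_unique)
  then have "AE y in N. (\<Sum>n. ?f n y) \<noteq> \<infinity>"
    by (intro nn_integral_PInf_AE) measurable
  moreover have "AE y in N. y \<in> \<Omega>" by (rule AE_I2) simp
  ultimately have "AE y in N. (\<lambda>n. v (k n) y) \<longlonglongrightarrow> u y"
  proof eventually_elim
    case (elim y)
    let ?p = "\<lambda>n. \<bar>v (k n) y - u y\<bar> * indicator (exhaustion n) y"
    have "(\<Sum>n. ennreal (?p n)) \<noteq> top"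
      using elim(1) by (simp add: ennreal_mult ennreal_indicator)
    then have "summable ?p" by (intro summable_suminf_not_top) auto
    then have "?p \<longlonglongrightarrow> 0" by (rule summable_LIMSEQ_zero)
    \<comment> \<open>A fixed point lies in all late exhaustion sets, so the cutoff disappears in
      the limit.\<close>
    moreover have "eventually (\<lambda>n. ?p n = \<bar>v (k n) y - u y\<bar>) sequentially"
      using eventually_in_exhaustion[OF elim(2)] by eventually_elim simp
    ultimately have "(\<lambda>n. \<bar>v (k n) y - u y\<bar>) \<longlonglongrightarrow> 0"
      by (rule Lim_transform_eventually)
    then show ?case by (simp add: LIM_zero_iff tendsto_rabs_zero_iff)
  qed
  then show thesis using that[of "\<lambda>n. v (k n)" "\<lambda>n. g (k n)"] cont g k by blast
qed

end

section \<open>Level sets\<close>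

lemma (in sigma_finite_measure) nn_integral_layer_cake:
  fixes f :: "'a \<Rightarrow> real"
  assumes [measurable]: "f \<in> borel_measurable M" and nonneg: "\<And>x. f x \<ge> 0"
  shows "(\<integral>\<^sup>+x. ennreal (f x) \<partial>M) = (\<integral>\<^sup>+t\<in>{0<..}. emeasure M {x\<in>space M. t < f x} \<partial>lborel)"
proof -
  interpret pair_sigma_finite M "lborel :: real measure" ..
  have "ennreal (f x) = (\<integral>\<^sup>+t. indicator {0<..} t * indicator {t. t < f x} t \<partial>lborel)" for x
  proof -
    have "(\<integral>\<^sup>+t. indicator {0<..} t * indicator {t. t < f x} t \<partial>lborel) = (\<integral>\<^sup>+t. indicator {0<..<f x} t \<partial>lborel)"
      by (intro nn_integral_cong) (auto simp: indicator_def)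
    then show ?thesis using nonneg[of x] by simp
  qed
  then have "(\<integral>\<^sup>+x. ennreal (f x) \<partial>M) = (\<integral>\<^sup>+x. \<integral>\<^sup>+t. indicator {0<..} t * indicator {t. t < f x} t \<partial>lborel \<partial>M)"
    by simp
  also have "\<dots> = (\<integral>\<^sup>+t. \<integral>\<^sup>+x. indicator {0<..} t * indicator {t. t < f x} t \<partial>M \<partial>lborel)"
    by (rule Fubini'[symmetric]) measurable
  also have "\<dots> = (\<integral>\<^sup>+t. emeasure M {x\<in>space M. t < f x} * indicator {0<..} t \<partial>lborel)"
  proof (intro nn_integral_cong)
    fix t :: real
    have "(\<integral>\<^sup>+x. indicator {0<..} t * indicator {t. t < f x} t \<partial>M) =
        (\<integral>\<^sup>+x. indicator {0<..} t * indicator {x\<in>space M. t < f x} x \<partial>M)"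
      by (intro nn_integral_cong) (auto simp: indicator_def)
    also have "\<dots> = indicator {0<..} t * emeasure M {x\<in>space M. t < f x}"
      by (subst nn_integral_cmult) auto
    finally show "(\<integral>\<^sup>+x. indicator {0<..} t * indicator {t. t < f x} t \<partial>M) =
        emeasure M {x\<in>space M. t < f x} * indicator {0<..} t" by (simp add: mult.commute)
  qed
  finally show ?thesis .
qed

text \<open>For fixed \<open>x\<close> the equation \<open>f x = t\<close> excludes a single
  \<open>t\<close>; exchanging the two quantifiers gives the claim. At the excluded levels the ramps
  need not converge.\<close>

lemma (in sigma_finite_measure) AE_level_set_null:
  fixes f :: "'a \<Rightarrow> real"
  assumes [measurable]: "f \<in> borel_measurable M"
  shows "AE t in lborel. AE x in M. f x \<noteq> t"
proof -
  interpret pair_sigma_finite M "lborel :: real measure" ..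
  have "AE x in M. AE t in lborel. f x \<noteq> t"
  proof (rule AE_I2)
    fix x
    show "AE t in lborel. f x \<noteq> t"
      using AE_lborel_singleton[of "f x"] by eventually_elim simp
  qed
  then show ?thesis by (subst (asm) AE_commute) measurable
qed

text \<open>For \<open>a = t\<close> the limit would depend on how fast \<open>z n - t\<close> tends
  to 0 compared with \<open>h n\<close>, hence the exclusion.\<close>

lemma tendsto_level_ramp:
  fixes z h :: "nat \<Rightarrow> real"
  assumes z: "z \<longlonglongrightarrow> a" and h: "h \<longlonglongrightarrow> 0" "\<And>n. h n > 0" and ne: "a \<noteq> t"
  shows "(\<lambda>n. level_ramp t (h n) (z n)) \<longlonglongrightarrow> (if t < a then 1 else 0)"
proof (cases "t < a")
  case True
  then have "eventually (\<lambda>n. (t + a) / 2 < z n) sequentially"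
    by (intro order_tendstoD(1)[OF z]) simp
  moreover have "eventually (\<lambda>n. h n < (a - t) / 2) sequentially"
    using True by (intro order_tendstoD(2)[OF h(1)]) simp
  ultimately have "eventually (\<lambda>n. level_ramp t (h n) (z n) = 1) sequentially"
  proof eventually_elim
    case (elim n)
    then have "1 \<le> (z n - t) / h n" using h(2)[of n] by (simp add: field_simps)
    then show ?case by (simp add: level_ramp_def)
  qed
  then show ?thesis using True by (simp add: tendsto_eventually)
next
  case False
  then have "eventually (\<lambda>n. z n < t) sequentially"
    using ne by (intro order_tendstoD(2)[OF z]) simp
  then have "eventually (\<lambda>n. level_ramp t (h n) (z n) = 0) sequentially"
  proof eventually_elim
    case (elim n)
    then have "(z n - t) / h n \<le> 0" using h(2)[of n] by (simp add: field_simps)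
    then show ?case by (simp add: level_ramp_def)
  qed
  then show ?thesis using False by (simp add: tendsto_eventually)
qed

context doubling_domain
begin

text \<open>Dominated convergence with the constant 1, which is integrable because the domain is
  bounded. Clamping to the unit interval replaces control of \<open>v\<close> near the
  boundary.\<close>

lemma level_ramp_tendsto_L1:
  fixes v :: "nat \<Rightarrow> 'a \<Rightarrow> real" and h :: "nat \<Rightarrow> real"
  assumes [measurable]: "\<And>n. v n \<in> borel_measurable N" "u \<in> borel_measurable N"
    and conv: "AE y in N. (\<lambda>n. v n y) \<longlonglongrightarrow> u y" and h: "h \<longlonglongrightarrow> 0" "\<And>n. h n > 0"
    and null: "AE y in N. \<bar>u y\<bar> \<noteq> t"
  shows "(\<lambda>n. \<integral>\<^sup>+y. ennreal \<bar>level_ramp t (h n) \<bar>v n y\<bar> - indicator {y\<in>\<Omega>. t < \<bar>u y\<bar>} y\<bar> \<partial>N) \<longlonglongrightarrow> 0"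
proof -
  have [measurable]: "level_ramp t r \<in> borel_measurable borel" for r
    unfolding level_ramp_def by measurable
  have [measurable]: "(indicator {y\<in>\<Omega>. t < \<bar>u y\<bar>} :: 'a \<Rightarrow> real) \<in> borel_measurable N"
  proof -
    have "{y\<in>space N. t < \<bar>u y\<bar>} \<in> sets N" by measurable
    then show ?thesis by simp
  qed
  let ?f = "\<lambda>n y. ennreal \<bar>level_ramp t (h n) \<bar>v n y\<bar> - indicator {y\<in>\<Omega>. t < \<bar>u y\<bar>} y\<bar>"
  have "(\<lambda>n. \<integral>\<^sup>+y. ?f n y \<partial>N) \<longlonglongrightarrow> (\<integral>\<^sup>+y. 0 \<partial>N)"
  proof (rule nn_integral_dominated_convergence[where w = "\<lambda>_. 1"])
    show "AE y in N. ?f n y \<le> 1" for n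
    proof (rule AE_I2)
      fix y
      show "?f n y \<le> 1"
        using level_ramp_bounds[of t "h n" "\<bar>v n y\<bar>"] by (auto simp: indicator_def)
    qed
    show "(\<integral>\<^sup>+y. 1 \<partial>N) < \<infinity>"
      using N.emeasure_finite[of \<Omega>] by (simp add: less_top[symmetric])
    have "AE y in N. y \<in> \<Omega>" by (rule AE_I2) simp
    with conv null show "AE y in N. (\<lambda>n. ?f n y) \<longlonglongrightarrow> 0"
    proof eventually_elim
      case (elim y)
      have "(\<lambda>n. level_ramp t (h n) \<bar>v n y\<bar>) \<longlonglongrightarrow> (if t < \<bar>u y\<bar> then 1 else 0)"
        using elim h by (intro tendsto_level_ramp tendsto_rabs) auto
      also have "(if t < \<bar>u y\<bar> then 1 else 0) = (indicator {y\<in>\<Omega>. t < \<bar>u y\<bar>} y :: real)"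
        using elim(3) by simp
      finally have "(\<lambda>n. \<bar>level_ramp t (h n) \<bar>v n y\<bar> - indicator {y\<in>\<Omega>. t < \<bar>u y\<bar>} y\<bar>) \<longlonglongrightarrow> 0"
        by (intro tendsto_rabs_zero) (simp add: LIM_zero)
      then show ?case by (simp flip: ennreal_0)
    qed
  qed measurable
  then show ?thesis by simp
qed

text \<open>Together with Fatou's lemma in the level \<open>t\<close>, this replaces the coarea formula.\<close>

lemma nn_integral_level_energy:
  assumes [measurable]: "v \<in> borel_measurable N" "g \<in> borel_measurable N" and h: "h > 0"
  shows "(\<integral>\<^sup>+t. \<integral>\<^sup>+y. g y * (ennreal (1 / h) * indicator {t..t + h} \<bar>v y\<bar>) \<partial>N \<partial>lborel) = (\<integral>\<^sup>+y. g y \<partial>N)"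
proof -
  have *: "indicator {t..t + h} z = (indicator {z - h..z} t :: ennreal)" for z t :: real
    by (auto simp: indicator_def)
  have "(\<integral>\<^sup>+t. \<integral>\<^sup>+y. g y * (ennreal (1 / h) * indicator {t..t + h} \<bar>v y\<bar>) \<partial>N \<partial>lborel) =
      (\<integral>\<^sup>+y. \<integral>\<^sup>+t. g y * (ennreal (1 / h) * indicator {t..t + h} \<bar>v y\<bar>) \<partial>lborel \<partial>N)"
    unfolding indicator_def atLeastAtMost_iff by (rule N_lborel.Fubini') measurable
  also have "\<dots> = (\<integral>\<^sup>+y. g y \<partial>N)"
  proof (rule nn_integral_cong)
    fix y
    have "(\<integral>\<^sup>+t. g y * (ennreal (1 / h) * indicator {t..t + h} \<bar>v y\<bar>) \<partial>lborel)
       = (\<integral>\<^sup>+t. g y * ennreal (1 / h) * indicator {\<bar>v y\<bar> - h..\<bar>v y\<bar>} t \<partial>lborel)"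
      by (simp add: * mult.assoc)
    also have "\<dots> = g y * (ennreal (1 / h) * ennreal h)"
      using h by (subst nn_integral_cmult) (simp_all add: mult.assoc)
    also have "\<dots> = g y" using h by (simp flip: ennreal_mult)
    finally show "(\<integral>\<^sup>+t. g y * (ennreal (1 / h) * indicator {t..t + h} \<bar>v y\<bar>) \<partial>lborel) = g y" .
  qed
  finally show ?thesis .
qed

lemma measurable_level_energy:
  assumes [measurable]: "v \<in> borel_measurable N" "g \<in> borel_measurable N"
  shows "(\<lambda>t. \<integral>\<^sup>+y. g y * (ennreal (1 / h) * indicator {t..t + h} \<bar>v y\<bar>) \<partial>N) \<in> borel_measurable lborel"
  \<comment> \<open>The indicator is unfolded to inequalities, since its set moves with
    \<open>t\<close> and measurability is needed jointly in \<open>t\<close> and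
    \<open>y\<close>.\<close>
  unfolding indicator_def atLeastAtMost_iff by measurable

end

section \<open>A relative isoperimetric inequality\<close>

text \<open>Removes the two averages from a Poincare inequality: multiplying by \<open>p\<close> on
  the left and by the larger \<open>q\<close> on the right keeps the estimate.\<close>

lemma ennreal_mean_le_imp_le:
  fixes X Y p q A :: ennreal
  assumes "X / p \<le> A * (Y / q)" "0 < p" "p \<le> q" "q < \<infinity>"
  shows "X \<le> A * Y"
proof -
  have p: "p \<noteq> 0" "p < top" and q: "q \<noteq> 0" "q < top" using assms by auto
  have "X = X / p * p" using p by (simp add: ennreal_divide_times ennreal_divide_self)
  also have "\<dots> \<le> A * (Y / q) * q"
    using assms by (intro mult_mono) auto
  also have "\<dots> = A * Y" using q by (simp add: mult.assoc ennreal_divide_times ennreal_divide_self)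
  finally show ?thesis .
qed

context doubling_domain
begin

lemma locally_integrable_bounded:
  assumes w: "w \<in> borel_measurable N" and bd: "\<And>y. 0 \<le> w y \<and> w y \<le> (1 :: real)"
  shows "locally_integrable_on \<mu> \<Omega> (\<lambda>y. ereal (w y))"
proof -
  have "(\<integral>\<^sup>+y\<in>V. e2ennreal \<bar>ereal (w y)\<bar> \<partial>M) < \<infinity>" if "compactly_inside V \<Omega>" for V
  proof -
    have V: "V \<in> sets M" "V \<subseteq> \<Omega>"
      using that closure_subset[of V] by (auto simp: compactly_inside_def intro: borel_sets_M)
    have "(\<integral>\<^sup>+y\<in>V. e2ennreal \<bar>ereal (w y)\<bar> \<partial>M) \<le> (\<integral>\<^sup>+y. indicator V y \<partial>M)"
      using bd by (intro nn_integral_mono) (auto simp: indicator_def e2ennreal_ereal)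
    also have "\<dots> = \<mu> V" using V by (simp add: emeasure_M)
    also have "\<dots> < \<infinity>" by (rule mu_bounded_finite[OF bounded_subset[OF bounded_domain V(2)]])
    finally show ?thesis .
  qed
  moreover have "(\<lambda>y. ereal (w y)) \<in> borel_measurable N" using w by measurable
  ultimately show ?thesis by (simp add: locally_integrable_on_def)
qed

text \<open>Of the mean value only the existence of some constant is kept, since
  \<open>isoperimetric_deviation\<close> holds for every \<open>c\<close>.\<close>

lemma poincare_real:
  assumes P: "poincare_inequality_on \<mu> \<Omega> P L" and x: "x \<in> \<Omega>" and r: "r > 0"
    and w: "w \<in> borel_measurable N" "\<And>y. 0 \<le> w y \<and> w y \<le> (1 :: real)"
    and g: "upper_gradient_on \<Omega> (\<lambda>y. ereal (w y)) g"
  obtains c where "(\<integral>\<^sup>+y\<in>ball x r. ennreal \<bar>w y - c\<bar> \<partial>N) \<le> ennreal (P * r) * (\<integral>\<^sup>+y\<in>ball x (L * r). g y \<partial>N)"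
proof
  let ?c = "mean_value \<mu> (ball x r \<inter> \<Omega>) (\<lambda>y. ereal (w y))"
  have int: "(\<integral>\<^sup>+y\<in>ball x s. f y \<partial>N) = (\<integral>\<^sup>+y\<in>ball x s \<inter> \<Omega>. f y \<partial>M)" for f s
    unfolding nn_integral_N by (intro nn_integral_cong) (auto simp: indicator_def)
  have fin: "\<mu> (ball x s \<inter> \<Omega>) < \<infinity>" for s
    by (rule mu_bounded_finite[OF bounded_subset[OF bounded_domain]]) auto
  have L: "L \<ge> 1" using P by (simp add: poincare_inequality_on_def)
  have "(\<integral>\<^sup>+y\<in>ball x r \<inter> \<Omega>. e2ennreal \<bar>ereal (w y)\<bar> \<partial>M) \<le> (\<integral>\<^sup>+y. indicator (ball x r \<inter> \<Omega>) y \<partial>M)"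
    using w by (intro nn_integral_mono) (auto simp: indicator_def e2ennreal_ereal)
  also have "\<dots> = \<mu> (ball x r \<inter> \<Omega>)" by (simp add: emeasure_M)
  also have "\<dots> < \<infinity>" by (rule fin)
  finally have "(\<integral>\<^sup>+y\<in>ball x r \<inter> \<Omega>. e2ennreal \<bar>ereal (w y) - ereal ?c\<bar> \<partial>M) / \<mu> (ball x r \<inter> \<Omega>)
      \<le> ennreal (P * r) * ((\<integral>\<^sup>+y\<in>ball x (L * r) \<inter> \<Omega>. g y \<partial>M) / \<mu> (ball x (L * r) \<inter> \<Omega>))"
    using P x r g locally_integrable_bounded[OF w] unfolding poincare_inequality_on_def by blast
  moreover have "0 < \<mu> (ball x r \<inter> \<Omega>)"
  proof -
    obtain e where "e > 0" "ball x e \<subseteq> \<Omega>" using open_domain x by (auto simp: open_contains_ball)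
    then have "\<mu> (ball x (min e r)) \<le> \<mu> (ball x r \<inter> \<Omega>)" by (intro mu_mono) auto
    moreover have "0 < \<mu> (ball x (min e r))" using r \<open>e > 0\<close> by (intro ball_pos) simp
    ultimately show ?thesis by simp
  qed
  moreover have "r \<le> L * r" using L r by simp
  then have "\<mu> (ball x r \<inter> \<Omega>) \<le> \<mu> (ball x (L * r) \<inter> \<Omega>)" by (intro mu_mono) auto
  ultimately have "(\<integral>\<^sup>+y\<in>ball x r \<inter> \<Omega>. e2ennreal \<bar>ereal (w y) - ereal ?c\<bar> \<partial>M)
      \<le> ennreal (P * r) * (\<integral>\<^sup>+y\<in>ball x (L * r) \<inter> \<Omega>. g y \<partial>M)"
    using fin by (rule ennreal_mean_le_imp_le)
  then show "(\<integral>\<^sup>+y\<in>ball x r. ennreal \<bar>w y - ?c\<bar> \<partial>N) \<le> ennreal (P * r) * (\<integral>\<^sup>+y\<in>ball x (L * r). g y \<partial>N)"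
    by (simp add: int e2ennreal_ereal)
qed

text \<open>On \<open>E\<close> the deviation is |1 - c|, off \<open>E\<close> it is |c|; the two
  add up to at least 1, and each is integrated over measure at least \<open>m\<close>.\<close>

lemma isoperimetric_deviation:
  assumes E: "E \<in> sets N" and B: "B \<in> sets N" and m: "m \<le> \<mu> (E \<inter> B)" "m \<le> \<mu> (B - E)"
  shows "m \<le> (\<integral>\<^sup>+y\<in>B. ennreal \<bar>indicator E y - c\<bar> \<partial>N)"
proof -
  have "1 \<le> ennreal \<bar>1 - c\<bar> + ennreal \<bar>c\<bar>"
    by (simp flip: ennreal_plus ennreal_1)
  then have "1 * m \<le> (ennreal \<bar>1 - c\<bar> + ennreal \<bar>c\<bar>) * m" by (rule mult_right_mono) simp
  also have "\<dots> \<le> ennreal \<bar>1 - c\<bar> * \<mu> (E \<inter> B) + ennreal \<bar>c\<bar> * \<mu> (B - E)"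
    unfolding distrib_right using m by (intro add_mono mult_left_mono) auto
  also have "\<dots> = ennreal \<bar>1 - c\<bar> * emeasure N (E \<inter> B) + ennreal \<bar>c\<bar> * emeasure N (B - E)"
    using E B by (simp add: emeasure_N sets.Int sets.Diff)
  also have "\<dots> = (\<integral>\<^sup>+y. ennreal \<bar>1 - c\<bar> * indicator (E \<inter> B) y + ennreal \<bar>c\<bar> * indicator (B - E) y \<partial>N)"
    using E B by (subst nn_integral_add) (auto simp: nn_integral_cmult_indicator)
  also have "\<dots> = (\<integral>\<^sup>+y\<in>B. ennreal \<bar>indicator E y - c\<bar> \<partial>N)"
    by (intro nn_integral_cong) (auto simp: indicator_def)
  finally show ?thesis by simp
qed

text \<open>The Poincare inequality concerns balls centred in \<Omega>, so a boundary centre is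
  moved by less than \<open>r\<close> to some \<open>x'\<close>: radius \<open>2 * r\<close> about
  \<open>x'\<close> covers \<open>ball x r\<close>, and radius \<open>2 * L * r\<close> about
  \<open>x'\<close> stays within \<open>(2 * L + 1) * r\<close> of \<open>x\<close>. The last term
  pays for replacing the indicator of \<open>E\<close> by \<open>w\<close>, to which the inequality
  is applied.\<close>

lemma relative_isoperimetric:
  assumes P: "poincare_inequality_on \<mu> \<Omega> P L" and x: "x \<in> closure \<Omega>" and r: "r > 0"
    and w: "w \<in> borel_measurable N" "\<And>y. 0 \<le> w y \<and> w y \<le> (1 :: real)"
    and g: "upper_gradient_on \<Omega> (\<lambda>y. ereal (w y)) g"
    and E: "E \<in> sets N" and m: "m \<le> \<mu> (E \<inter> ball x r)" "m \<le> \<mu> (\<Omega> \<inter> ball x r - E)"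
  shows "m \<le> ennreal (2 * P * r) * (\<integral>\<^sup>+y\<in>ball x ((2 * L + 1) * r). g y \<partial>N) + (\<integral>\<^sup>+y. ennreal \<bar>w y - indicator E y\<bar> \<partial>N)"
proof -
  obtain x' where x': "x' \<in> \<Omega>" "dist x' x < r" using x r by (auto simp: closure_approachable)
  obtain c where c: "(\<integral>\<^sup>+y\<in>ball x' (2 * r). ennreal \<bar>w y - c\<bar> \<partial>N) \<le> ennreal (P * (2 * r)) * (\<integral>\<^sup>+y\<in>ball x' (L * (2 * r)). g y \<partial>N)"
    using poincare_real[OF P x'(1) _ w g, of "2 * r"] r by auto
  have Ei: "(indicator E :: 'a \<Rightarrow> real) \<in> borel_measurable N" using E by simp
  have "E \<subseteq> \<Omega>" using E by (simp add: sets_N_iff)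
  then have "E \<inter> (\<Omega> \<inter> ball x r) = E \<inter> ball x r" by auto
  then have "m \<le> (\<integral>\<^sup>+y\<in>\<Omega> \<inter> ball x r. ennreal \<bar>indicator E y - c\<bar> \<partial>N)"
    using m by (intro isoperimetric_deviation[OF E]) auto
  also have "\<dots> \<le> (\<integral>\<^sup>+y. ennreal \<bar>w y - c\<bar> * indicator (\<Omega> \<inter> ball x r) y + ennreal \<bar>w y - indicator E y\<bar> \<partial>N)"
  proof (rule nn_integral_mono)
    fix y
    have "ennreal \<bar>indicator E y - c\<bar> \<le> ennreal \<bar>w y - c\<bar> + ennreal \<bar>w y - indicator E y\<bar>"
      by (simp flip: ennreal_plus)
    then show "ennreal \<bar>indicator E y - c\<bar> * indicator (\<Omega> \<inter> ball x r) y
        \<le> ennreal \<bar>w y - c\<bar> * indicator (\<Omega> \<inter> ball x r) y + ennreal \<bar>w y - indicator E y\<bar>"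
      by (auto simp: indicator_def)
  qed
  also have "\<dots> = (\<integral>\<^sup>+y\<in>\<Omega> \<inter> ball x r. ennreal \<bar>w y - c\<bar> \<partial>N) + (\<integral>\<^sup>+y. ennreal \<bar>w y - indicator E y\<bar> \<partial>N)"
  proof (rule nn_integral_add)
    have "(indicator (\<Omega> \<inter> ball x r) :: 'a \<Rightarrow> ennreal) \<in> borel_measurable N"
      by (rule borel_measurable_indicator) simp
    then show "(\<lambda>y. ennreal \<bar>w y - c\<bar> * indicator (\<Omega> \<inter> ball x r) y) \<in> borel_measurable N"
      using w(1) by measurable
    show "(\<lambda>y. ennreal \<bar>w y - indicator E y\<bar>) \<in> borel_measurable N"
      using w(1) Ei by measurable
  qed
  finally have 1: "m \<le> (\<integral>\<^sup>+y\<in>\<Omega> \<inter> ball x r. ennreal \<bar>w y - c\<bar> \<partial>N) + (\<integral>\<^sup>+y. ennreal \<bar>w y - indicator E y\<bar> \<partial>N)" .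
  have "(\<integral>\<^sup>+y\<in>\<Omega> \<inter> ball x r. ennreal \<bar>w y - c\<bar> \<partial>N) \<le> (\<integral>\<^sup>+y\<in>ball x' (2 * r). ennreal \<bar>w y - c\<bar> \<partial>N)"
  proof (rule nn_integral_mono)
    fix y
    have "dist x' y < 2 * r" if "dist x y < r"
      using dist_triangle[of x' y x] x'(2) that by linarith
    then show "ennreal \<bar>w y - c\<bar> * indicator (\<Omega> \<inter> ball x r) y \<le> ennreal \<bar>w y - c\<bar> * indicator (ball x' (2 * r)) y"
      by (auto simp: indicator_def)
  qed
  also note c
  finally have 0: "(\<integral>\<^sup>+y\<in>\<Omega> \<inter> ball x r. ennreal \<bar>w y - c\<bar> \<partial>N) \<le> ennreal (P * (2 * r)) * (\<integral>\<^sup>+y\<in>ball x' (L * (2 * r)). g y \<partial>N)" .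
  have 2: "(\<integral>\<^sup>+y\<in>ball x' (L * (2 * r)). g y \<partial>N) \<le> (\<integral>\<^sup>+y\<in>ball x ((2 * L + 1) * r). g y \<partial>N)"
  proof (rule nn_integral_mono)
    fix y
    have "dist x y < (2 * L + 1) * r" if "dist x' y < L * (2 * r)"
      using dist_triangle[of x y x'] x'(2) that by (simp add: dist_commute algebra_simps)
    then show "g y * indicator (ball x' (L * (2 * r))) y \<le> g y * indicator (ball x ((2 * L + 1) * r)) y"
      by (auto simp: indicator_def)
  qed
  note 3 = order_trans[OF 0 mult_left_mono[OF 2]]
  show ?thesis
    using order_trans[OF 1 add_right_mono[OF 3]] by (simp add: mult_ac)
qed

end

section \<open>The Hausdorff measure of boundary level sets\<close>

locale trace_domain = doubling_domain +
  fixes P L c H :: real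
  assumes poincare: "poincare_inequality_on \<mu> \<Omega> P L"
    and c_pos: "c > 0"
    and density: "\<And>x r. x \<in> frontier \<Omega> \<Longrightarrow> 0 < r \<Longrightarrow> r < diameter \<Omega> \<Longrightarrow>
      ennreal c * \<mu> (ball x r) \<le> \<mu> (ball x r \<inter> \<Omega>)"
    and H_pos: "H > 0"
    and codim1_upper: "\<And>x r. x \<in> frontier \<Omega> \<Longrightarrow> 0 < r \<Longrightarrow> r < 2 * diameter \<Omega> \<Longrightarrow>
      codim1_hausdorff \<mu> (ball x r \<inter> frontier \<Omega>) \<le> ennreal H * (\<mu> (ball x r) / ennreal r)"
begin

lemma P_pos: "P > 0" and L_ge_1: "L \<ge> 1"
  using poincare by (auto simp: poincare_inequality_on_def)

lemma frontier_in_closure: "x \<in> frontier \<Omega> \<Longrightarrow> x \<in> closure \<Omega>"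
  by (simp add: frontier_def)

text \<open>A boundary point lies outside the open set, so two points of \<Omega> can be found at
  different distances from it; they are distinct.\<close>

lemma diameter_pos:
  assumes "x \<in> frontier \<Omega>" shows "diameter \<Omega> > 0"
proof -
  have x: "x \<in> closure \<Omega>" "x \<notin> \<Omega>"
    using assms open_domain by (auto simp: frontier_def interior_open)
  then obtain y where y: "y \<in> \<Omega>" by (metis closure_empty empty_iff equals0I)
  then have "dist y x > 0" using x by auto
  then obtain z where z: "z \<in> \<Omega>" "dist z x < dist y x"
    using x(1) unfolding closure_approachable by blast
  then have "0 < dist y z" by auto
  also have "\<dots> \<le> diameter \<Omega>" using diameter_bounded_bound[OF bounded_domain y z(1)] .
  finally show ?thesis .
qed

section \<open>Real-valued masses, level sets near the boundary, and stopping radii\<close>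

definition mass :: "'a set \<Rightarrow> real" where "mass A = enn2real (\<mu> A)"

lemma mass_nonneg [simp]: "mass A \<ge> 0" by (simp add: mass_def)

lemma mu_eq_mass: "bounded A \<Longrightarrow> \<mu> A = ennreal (mass A)"
  using mu_bounded_finite[of A] by (simp add: mass_def)

lemma bounded_sets_N: "A \<in> sets N \<Longrightarrow> bounded A"
  by (rule bounded_subset[OF bounded_domain]) (simp add: sets_N_iff)

lemma mu_eq_mass_N: "A \<in> sets N \<Longrightarrow> \<mu> A = ennreal (mass A)"
  by (intro mu_eq_mass bounded_sets_N)

lemma mass_split:
  assumes "E \<in> sets N" "B \<in> sets N"
  shows "mass B = mass (E \<inter> B) + mass (B - E)"
proof -
  have "emeasure N (E \<inter> B) + emeasure N (B - E) = emeasure N ((E \<inter> B) \<union> (B - E))"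
    using assms by (intro plus_emeasure) (auto intro: sets.Int sets.Diff)
  also have "(E \<inter> B) \<union> (B - E) = B" by auto
  finally have "ennreal (mass (E \<inter> B) + mass (B - E)) = ennreal (mass B)"
    using assms by (simp add: emeasure_N mu_eq_mass_N sets.Int sets.Diff)
  then show ?thesis by (subst (asm) ennreal_inj) auto
qed

lemma mass_mono: "A \<subseteq> B \<Longrightarrow> bounded B \<Longrightarrow> mass A \<le> mass B"
  unfolding mass_def using mu_bounded_finite by (intro enn2real_mono mu_mono) auto

lemma mass_density:
  assumes "x \<in> frontier \<Omega>" "0 < r" "r < diameter \<Omega>"
  shows "c * mass (ball x r) \<le> mass (\<Omega> \<inter> ball x r)"
proof -
  have "ennreal c * ennreal (mass (ball x r)) \<le> ennreal (mass (\<Omega> \<inter> ball x r))"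
    using density[OF assms] by (simp add: mu_eq_mass_N mu_eq_mass[symmetric] Int_commute)
  then show ?thesis using c_pos by (simp flip: ennreal_mult)
qed

lemma mass_ball_pos: "r > 0 \<Longrightarrow> mass (ball x r) > 0"
  using ball_pos[of r x] ball_finite[of x r] by (simp add: mass_def enn2real_positive_iff)

text \<open>Chebyshev's inequality: off \<open>E\<close> the difference |u - a| is at least
  \<open>\<delta>\<close>, that is |a| - t, so an average below \<open>\<delta> / 2\<close> leaves
  less than half of the ball to the complement of \<open>E\<close>.\<close>

lemma level_set_density:
  assumes u: "u \<in> borel_measurable N" and x: "x \<in> frontier \<Omega>" and t: "t < \<bar>a\<bar>"
    and lim: "((\<lambda>r. (\<integral>\<^sup>+y\<in>\<Omega> \<inter> ball x r. ennreal \<bar>u y - a\<bar> \<partial>M) / \<mu> (\<Omega> \<inter> ball x r)) \<longlongrightarrow> 0) (at_right 0)"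
  defines "E \<equiv> {y\<in>\<Omega>. t < \<bar>u y\<bar>}"
  shows "eventually (\<lambda>r. mass (\<Omega> \<inter> ball x r) < 2 * mass (E \<inter> ball x r)) (at_right 0)"
proof -
  define \<delta> where "\<delta> = \<bar>a\<bar> - t"
  have \<delta>: "\<delta> > 0" using t by (simp add: \<delta>_def)
  have "{y\<in>space N. t < \<bar>u y\<bar>} \<in> sets N" using u by measurable
  then have E: "E \<in> sets N" by (simp add: E_def)
  have "eventually (\<lambda>r. (\<integral>\<^sup>+y\<in>\<Omega> \<inter> ball x r. ennreal \<bar>u y - a\<bar> \<partial>M) / \<mu> (\<Omega> \<inter> ball x r) < ennreal (\<delta> / 2)) (at_right 0)"
    using \<delta> by (intro order_tendstoD(2)[OF lim]) simp
  moreover have "eventually (\<lambda>r. r \<in> {0<..<diameter \<Omega>}) (at_right 0)"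
    by (rule eventually_at_right_real[OF diameter_pos[OF x]])
  ultimately show ?thesis
  proof eventually_elim
    case (elim r)
    let ?B = "\<Omega> \<inter> ball x r"
    have sets: "?B \<in> sets N" "?B - E \<in> sets N" "E \<inter> ?B \<in> sets N" using E by auto
    have p: "0 < mass ?B"
      using mass_density[OF x, of r] mass_ball_pos[of r x] c_pos elim(2)
      by (auto intro: less_le_trans[of 0 "c * mass (ball x r)"])
    have "ennreal (\<delta> * mass (?B - E)) = ennreal \<delta> * emeasure M (?B - E)"
      using \<delta> sets by (simp add: ennreal_mult emeasure_M sets_N_iff mu_eq_mass_N)
    also have "\<dots> = (\<integral>\<^sup>+y. ennreal \<delta> * indicator (?B - E) y \<partial>M)"
      using sets by (subst nn_integral_cmult_indicator) (auto simp: sets_N_iff)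
    also have "\<dots> \<le> (\<integral>\<^sup>+y\<in>?B. ennreal \<bar>u y - a\<bar> \<partial>M)"
    proof (rule nn_integral_mono)
      fix y
      have "\<delta> \<le> \<bar>u y - a\<bar>" if "\<bar>u y\<bar> \<le> t" using that by (simp add: \<delta>_def)
      then show "ennreal \<delta> * indicator (?B - E) y \<le> ennreal \<bar>u y - a\<bar> * indicator ?B y"
        by (auto simp: indicator_def E_def intro!: ennreal_leI)
    qed
    finally have "ennreal (\<delta> * mass (?B - E)) / ennreal (mass ?B) \<le> (\<integral>\<^sup>+y\<in>?B. ennreal \<bar>u y - a\<bar> \<partial>M) / \<mu> ?B"
      using sets by (simp add: mu_eq_mass_N divide_right_mono_ennreal)
    also have "\<dots> < ennreal (\<delta> / 2)" by (rule elim(1))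
    finally have "\<delta> * mass (?B - E) / mass ?B < \<delta> / 2"
      using p \<delta> by (simp add: divide_ennreal ennreal_less_iff)
    then have "2 * mass (?B - E) < mass ?B" using p \<delta> by (simp add: field_simps)
    moreover have "mass ?B = mass (E \<inter> ?B) + mass (?B - E)" using E sets by (intro mass_split)
    moreover have "E \<inter> ?B = E \<inter> ball x r" by (auto simp: E_def)
    ultimately show ?case by simp
  qed
qed

text \<open>Along radii halved from \<open>R\<close>, the share of \<open>E\<close> in the domain
  part of the ball must at some step pass from at most half to more than half. At the larger radius
  \<open>r\<close> the complement still has half; \<open>E\<close> has more than half at
  \<open>r / 2\<close>, and passing from \<open>r / 2\<close> to \<open>r\<close> costs the factor
  \<open>D\<close> in \<open>c / (2 * D)\<close>.\<close>

lemma stopping_radius: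
  assumes D: "D \<ge> 1" "\<And>x r. r > 0 \<Longrightarrow> \<mu> (ball x (2 * r)) \<le> ennreal D * \<mu> (ball x r)"
    and x: "x \<in> frontier \<Omega>" and E: "E \<in> sets N" and R: "0 < R" "R < diameter \<Omega>"
    and dens: "eventually (\<lambda>r. mass (\<Omega> \<inter> ball x r) < 2 * mass (E \<inter> ball x r)) (at_right 0)"
    and start: "2 * mass (E \<inter> ball x R) \<le> mass (\<Omega> \<inter> ball x R)"
  shows "\<exists>r. 0 < r \<and> r \<le> R \<and> c / (2 * D) * mass (ball x r) \<le> mass (E \<inter> ball x r) \<and>
    c / (2 * D) * mass (ball x r) \<le> mass (\<Omega> \<inter> ball x r - E)"
proof -
  let ?r = "\<lambda>n::nat. R * (1 / 2) ^ n"
  let ?Q = "\<lambda>n. mass (\<Omega> \<inter> ball x (?r n)) < 2 * mass (E \<inter> ball x (?r n))"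
  have "?r \<longlonglongrightarrow> R * 0" by (intro tendsto_intros LIMSEQ_realpow_zero) auto
  then have "filterlim ?r (at_right 0) sequentially"
    using R by (intro tendsto_imp_filterlim_at_right) auto
  then have "eventually ?Q sequentially"
    using dens unfolding filterlim_iff by (elim allE) (rule mp)
  then obtain n where Qn: "?Q n" using eventually_happens' sequentially_bot by blast
  have "\<exists>k. \<not> ?Q k \<and> ?Q (Suc k)"
  proof (rule ccontr)
    assume *: "\<not> ?thesis"
    have "\<not> ?Q k" for k
      by (induction k) (use start * in auto)
    then show False using Qn by blast
  qed
  then obtain k where k: "\<not> ?Q k" "?Q (Suc k)" by blast
  define r where "r = ?r k"
  have half: "?r (Suc k) = r / 2" by (simp add: r_def)
  have r: "0 < r" "r \<le> R" using R by (auto simp: r_def power_le_one mult_le_cancel_left1)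
  have "mass (ball x r) \<le> D * mass (ball x (r / 2))"
  proof -
    have "ennreal (mass (ball x r)) \<le> ennreal D * ennreal (mass (ball x (r / 2)))"
      using D(2)[of "r / 2" x] r by (simp flip: mu_eq_mass)
    then show ?thesis using D(1) by (simp flip: ennreal_mult)
  qed
  then have "c / (2 * D) * mass (ball x r) \<le> c / (2 * D) * (D * mass (ball x (r / 2)))"
    using c_pos D(1) by (intro mult_left_mono) auto
  also have "\<dots> = c * mass (ball x (r / 2)) / 2" using D(1) by simp
  also have "\<dots> \<le> mass (\<Omega> \<inter> ball x (r / 2)) / 2"
    using mass_density[OF x, of "r / 2"] r R by simp
  also have "\<dots> \<le> mass (E \<inter> ball x (r / 2))" using k(2) unfolding half by simp
  also have "\<dots> \<le> mass (E \<inter> ball x r)"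
    using r by (intro mass_mono) auto
  finally have 1: "c / (2 * D) * mass (ball x r) \<le> mass (E \<inter> ball x r)" .
  have "E \<inter> (\<Omega> \<inter> ball x r) = E \<inter> ball x r" using E by (auto simp: sets_N_iff)
  then have split: "mass (\<Omega> \<inter> ball x r) = mass (E \<inter> ball x r) + mass (\<Omega> \<inter> ball x r - E)"
    using mass_split[OF E, of "\<Omega> \<inter> ball x r"] by simp
  have "c / (2 * D) * mass (ball x r) \<le> c / 2 * mass (ball x r)"
    using c_pos D(1) by (intro mult_right_mono) (auto simp: field_simps)
  also have "\<dots> \<le> mass (\<Omega> \<inter> ball x r) / 2"
    using mass_density[OF x, of r] r R by simp
  also have "\<dots> \<le> mass (\<Omega> \<inter> ball x r - E)"
    using k(1) split unfolding r_def by simp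
  finally show ?thesis using 1 r by blast
qed


text \<open>The threefold enlargement of the ball on which the Poincare inequality is used at this scale still has
  radius less than \<open>2 * diameter \<Omega>\<close>, so the Hausdorff measure bound applies to it.\<close>

definition "stop_scale = diameter \<Omega> / (3 * (2 * L + 1))"

lemma stop_scale_eq: "3 * (2 * L + 1) * stop_scale = diameter \<Omega>"
proof -
  have "3 * (2 * L + 1) \<noteq> 0" using L_ge_1 by simp
  then show ?thesis unfolding stop_scale_def by (metis nonzero_mult_div_cancel_left times_divide_eq_right)
qed

text \<open>Once the error term is below half of \<open>\<kappa> * mass (ball x r)\<close>, the
  other half is bounded by \<open>2 * P * r\<close> times the energy, whence the constant
  \<open>4 * P / \<kappa>\<close>. How late this happens may depend on the ball, which is why the
  liminf is taken for each ball separately.\<close>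

lemma switching_ball_estimate:
  assumes x: "x \<in> frontier \<Omega>" and r: "r > 0" and \<kappa>: "\<kappa> > 0" and E: "E \<in> sets N"
    and w: "\<And>n. w n \<in> borel_measurable N" "\<And>n y. 0 \<le> w n y \<and> w n y \<le> (1 :: real)"
    and G: "\<And>n::nat. upper_gradient_on \<Omega> (\<lambda>y. ereal (w n y)) (G n)"
    and conv: "(\<lambda>n. \<integral>\<^sup>+y. ennreal \<bar>w n y - indicator E y\<bar> \<partial>N) \<longlonglongrightarrow> 0"
    and m: "\<kappa> * mass (ball x r) \<le> mass (E \<inter> ball x r)" "\<kappa> * mass (ball x r) \<le> mass (\<Omega> \<inter> ball x r - E)"
  shows "ennreal (mass (ball x r) / r)
    \<le> ennreal (4 * P / \<kappa>) * liminf (\<lambda>n. \<integral>\<^sup>+y\<in>ball x ((2 * L + 1) * r). G n y \<partial>N)"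
proof -
  let ?m = "\<kappa> * mass (ball x r)"
  let ?b = "\<lambda>n. \<integral>\<^sup>+y\<in>ball x ((2 * L + 1) * r). G n y \<partial>N"
  let ?e = "\<lambda>n. \<integral>\<^sup>+y. ennreal \<bar>w n y - indicator E y\<bar> \<partial>N"
  have mpos: "?m > 0" using mass_ball_pos[OF r, of x] \<kappa> by simp
  have "E \<inter> ball x r = E \<inter> (\<Omega> \<inter> ball x r)" using E by (auto simp: sets_N_iff)
  then have sets: "E \<inter> ball x r \<in> sets N" "\<Omega> \<inter> ball x r - E \<in> sets N"
    using E by (auto intro: sets.Int sets.Diff)
  have iso: "ennreal ?m \<le> ennreal (2 * P * r) * ?b n + ?e n" for n
    using m sets by (intro relative_isoperimetric[OF poincare frontier_in_closure[OF x] r w G E])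
      (auto simp: mu_eq_mass_N intro: ennreal_leI)
  have "eventually (\<lambda>n. ?e n < ennreal (?m / 2)) sequentially"
    using mpos by (intro order_tendstoD(2)[OF conv]) simp
  then have "eventually (\<lambda>n. ennreal (?m / (4 * P * r)) \<le> ?b n) sequentially"
  proof eventually_elim
    case (elim n)
    have "ennreal (?m / 2) \<le> ennreal (2 * P * r) * ?b n"
    proof (cases "ennreal (2 * P * r) * ?b n")
      case (real q)
      have "ennreal ?m \<le> ennreal q + ennreal (?m / 2)"
        using iso[of n] elim unfolding real by (meson add_left_mono less_imp_le order_trans)
      then show ?thesis using real mpos by (simp flip: ennreal_plus add: ennreal_leI)
    qed simp
    then have "ennreal (1 / (2 * P * r)) * ennreal (?m / 2) \<le> ennreal (1 / (2 * P * r)) * (ennreal (2 * P * r) * ?b n)"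
      by (rule mult_left_mono) simp
    also have "\<dots> = ennreal (1 / (2 * P * r) * (2 * P * r)) * ?b n"
      using P_pos r by (subst ennreal_mult) (simp_all add: mult.assoc)
    also have "1 / (2 * P * r) * (2 * P * r) = 1" using P_pos r by simp
    finally show ?case using P_pos r mpos by (simp flip: ennreal_mult add: field_simps)
  qed
  then have "ennreal (?m / (4 * P * r)) \<le> liminf ?b" by (rule Liminf_bounded)
  then have "ennreal (4 * P / \<kappa>) * ennreal (?m / (4 * P * r)) \<le> ennreal (4 * P / \<kappa>) * liminf ?b"
    by (rule mult_left_mono) simp
  moreover have "4 * P / \<kappa> * (?m / (4 * P * r)) = mass (ball x r) / r"
    using P_pos \<kappa> by simp
  ultimately show ?thesis using P_pos \<kappa> mpos r by (simp flip: ennreal_mult)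
qed

lemma sum_disjoint_energy_le:
  assumes "countable S" "pairwise (\<lambda>x y. disjnt (ball x (\<rho> x)) (ball y (\<rho> y))) S"
    and g: "g \<in> borel_measurable N"
  shows "(\<integral>\<^sup>+x. (\<integral>\<^sup>+y\<in>ball x (\<rho> x). g y \<partial>N) \<partial>count_space S) \<le> (\<integral>\<^sup>+y. g y \<partial>N)"
proof -
  have "(\<integral>\<^sup>+y\<in>ball x (\<rho> x). g y \<partial>N) = emeasure (density N g) (ball x (\<rho> x) \<inter> \<Omega>)" for x
    using g by (subst emeasure_density) (auto intro!: nn_integral_cong simp: indicator_def)
  then have "(\<integral>\<^sup>+x. (\<integral>\<^sup>+y\<in>ball x (\<rho> x). g y \<partial>N) \<partial>count_space S) =
      (\<integral>\<^sup>+x. emeasure (density N g) (ball x (\<rho> x) \<inter> \<Omega>) \<partial>count_space S)" by simp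
  also have "\<dots> = emeasure (density N g) (\<Union>x\<in>S. ball x (\<rho> x) \<inter> \<Omega>)"
    using assms(1,2)
    by (intro emeasure_UN_countable[symmetric])
      (auto simp: disjoint_family_on_def pairwise_def disjnt_def)
  also have "\<dots> \<le> emeasure (density N g) (space N)"
    by (intro emeasure_mono) (auto simp: sets_N_iff)
  also have "\<dots> = (\<integral>\<^sup>+y. g y \<partial>N)"
    unfolding emeasure_density[OF g sets.top] by (intro nn_integral_cong) auto
  finally show ?thesis .
qed

text \<open>The balls of radius \<open>(2 * L + 1) * r x\<close> are the ones made disjoint, because
  the energies live on them; the covering balls are three times larger. In the constant,
  \<open>H\<close> comes from the boundary bound on a covering ball, while \<open>D\<close> and the
  divisor \<open>3 * (2 * L + 1)\<close> come from returning to mass over radius at the original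
  scale.\<close>

lemma switching_set_estimate:
  assumes A: "A \<subseteq> frontier \<Omega>" and \<kappa>: "\<kappa> > 0" and E: "E \<in> sets N"
    and w: "\<And>n. w n \<in> borel_measurable N" "\<And>n y. 0 \<le> w n y \<and> w n y \<le> (1 :: real)"
    and G: "\<And>n::nat. upper_gradient_on \<Omega> (\<lambda>y. ereal (w n y)) (G n)"
    and conv: "(\<lambda>n. \<integral>\<^sup>+y. ennreal \<bar>w n y - indicator E y\<bar> \<partial>N) \<longlonglongrightarrow> 0"
    and switch: "\<forall>x\<in>A. \<exists>r. 0 < r \<and> r \<le> stop_scale \<and> \<kappa> * mass (ball x r) \<le> mass (E \<inter> ball x r) \<and>
      \<kappa> * mass (ball x r) \<le> mass (\<Omega> \<inter> ball x r - E)"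
    and D: "D \<ge> 1" "\<And>x r. r > 0 \<Longrightarrow> \<mu> (ball x (3 * (2 * L + 1) * r)) \<le> ennreal D * \<mu> (ball x r)"
  shows "codim1_hausdorff \<mu> A \<le> ennreal (H * D / (3 * (2 * L + 1)) * (4 * P / \<kappa>)) * liminf (\<lambda>n. \<integral>\<^sup>+y. G n y \<partial>N)"
proof -
  define \<sigma> where "\<sigma> = 2 * L + 1"
  have \<sigma>: "\<sigma> > 0" using L_ge_1 by (simp add: \<sigma>_def)
  obtain r where r: "\<And>x. x \<in> A \<Longrightarrow> 0 < r x" "\<And>x. x \<in> A \<Longrightarrow> r x \<le> stop_scale"
    "\<And>x. x \<in> A \<Longrightarrow> \<kappa> * mass (ball x (r x)) \<le> mass (E \<inter> ball x (r x))"
    "\<And>x. x \<in> A \<Longrightarrow> \<kappa> * mass (ball x (r x)) \<le> mass (\<Omega> \<inter> ball x (r x) - E)"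
    using bchoice[OF switch] by blast
  have "0 < \<sigma> * r x \<and> \<sigma> * r x \<le> \<sigma> * stop_scale" if "x \<in> A" for x
    using r(1,2)[OF that] \<sigma> by simp
  then obtain S where S: "S \<subseteq> A" "pairwise (\<lambda>x y. disjnt (ball x (\<sigma> * r x)) (ball y (\<sigma> * r y))) S"
    "A \<subseteq> (\<Union>x\<in>S. ball x (3 * (\<sigma> * r x)))"
    by (rule vitali_covering_centers)
  \<comment> \<open>Centres on the bounded boundary and bounded radii keep all disjoint balls in one
    ball, which makes \<open>S\<close> countable.\<close>
  obtain p Q where pQ: "frontier \<Omega> \<subseteq> ball p Q"
    using bounded_subset_ballD[of "frontier \<Omega>"] bounded_closure[OF bounded_domain]
    by (metis bounded_subset closure_subset frontier_def Diff_subset)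
  have "ball x (\<sigma> * r x) \<subseteq> ball p (Q + \<sigma> * stop_scale)" if "x \<in> S" for x
  proof
    fix y assume "y \<in> ball x (\<sigma> * r x)"
    moreover have "x \<in> ball p Q" using pQ that S(1) A by blast
    then have "dist p x < Q" by simp
    moreover have "\<sigma> * r x \<le> \<sigma> * stop_scale" using r(2)[of x] that S(1) \<sigma> by auto
    ultimately show "y \<in> ball p (Q + \<sigma> * stop_scale)"
      using dist_triangle[of p y x] by simp
  qed
  then have cS: "countable S"
    using r(1) S(1) \<sigma> by (intro countable_disjoint_balls[OF S(2), of "ball p (Q + \<sigma> * stop_scale)"]) auto
  let ?b = "\<lambda>n x. \<integral>\<^sup>+y\<in>ball x (\<sigma> * r x). G n y \<partial>N"
  let ?K = "ennreal (H * D / (3 * \<sigma>) * (4 * P / \<kappa>))"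
  have K: "?K = ennreal (H * D / (3 * \<sigma>)) * ennreal (4 * P / \<kappa>)"
    using H_pos D \<sigma> P_pos \<kappa> by (subst ennreal_mult) auto
  have ball: "codim1_hausdorff \<mu> (ball x (3 * (\<sigma> * r x)) \<inter> frontier \<Omega>) \<le> ?K * liminf (\<lambda>n. ?b n x)"
    if xS: "x \<in> S" for x
  proof -
    have x: "x \<in> frontier \<Omega>" and xA: "x \<in> A" using xS S A by auto
    have "3 * (\<sigma> * r x) \<le> 3 * \<sigma> * stop_scale"
      using r(2)[OF xA] \<sigma> by simp
    then have "3 * (\<sigma> * r x) \<le> diameter \<Omega>"
      unfolding \<sigma>_def stop_scale_eq .
    then have "codim1_hausdorff \<mu> (ball x (3 * (\<sigma> * r x)) \<inter> frontier \<Omega>)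
       \<le> ennreal H * (\<mu> (ball x (3 * (\<sigma> * r x))) / ennreal (3 * (\<sigma> * r x)))"
      using r(1)[OF xA] \<sigma> diameter_pos[OF x] by (intro codim1_upper[OF x]) auto
    also have "\<mu> (ball x (3 * (\<sigma> * r x))) \<le> ennreal (D * mass (ball x (r x)))"
    proof -
      have "3 * (\<sigma> * r x) = 3 * (2 * L + 1) * r x" by (simp add: \<sigma>_def)
      then show ?thesis
        using D(2)[OF r(1)[OF xA], of x] D(1) by (simp only: ennreal_mult mu_eq_mass bounded_ball mass_nonneg)
    qed
    also have "ennreal H * (ennreal (D * mass (ball x (r x))) / ennreal (3 * (\<sigma> * r x)))
        = ennreal (H * D / (3 * \<sigma>)) * ennreal (mass (ball x (r x)) / r x)"
      using r(1)[OF xA] \<sigma> D(1) H_pos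
      by (simp add: divide_ennreal ennreal_mult[symmetric])
    also have "ennreal (mass (ball x (r x)) / r x) \<le> ennreal (4 * P / \<kappa>) * liminf (\<lambda>n. ?b n x)"
      unfolding \<sigma>_def
      by (rule switching_ball_estimate[OF x r(1)[OF xA] \<kappa> E w G conv r(3)[OF xA] r(4)[OF xA]])
    finally show ?thesis
      unfolding K by (simp add: divide_right_mono_ennreal mult_left_mono mult.assoc)
  qed
  have Gm: "G n \<in> borel_measurable N" for n
    using G[of n] by (intro borel_measurable_N) (simp add: upper_gradient_on_def)
  have "A \<subseteq> (\<Union>x\<in>S. ball x (3 * (\<sigma> * r x)) \<inter> frontier \<Omega>)" using S(3) A by blast
  then have "codim1_hausdorff \<mu> A \<le> codim1_hausdorff \<mu> (\<Union>x\<in>S. ball x (3 * (\<sigma> * r x)) \<inter> frontier \<Omega>)"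
    by (rule codim1_hausdorff_mono)
  also have "\<dots> \<le> (\<integral>\<^sup>+x. codim1_hausdorff \<mu> (ball x (3 * (\<sigma> * r x)) \<inter> frontier \<Omega>) \<partial>count_space S)"
    by (rule codim1_hausdorff_countable_UN_le[OF cS])
  also have "\<dots> \<le> (\<integral>\<^sup>+x. ?K * liminf (\<lambda>n. ?b n x) \<partial>count_space S)"
    using ball by (intro nn_integral_mono) simp
  also have "\<dots> = ?K * (\<integral>\<^sup>+x. liminf (\<lambda>n. ?b n x) \<partial>count_space S)"
    by (rule nn_integral_cmult) simp
  \<comment> \<open>Fatou's lemma for the counting measure: a single liminf for all balls is needed
    before the disjoint energies can be added.\<close>
  also have "\<dots> \<le> ?K * liminf (\<lambda>n. \<integral>\<^sup>+x. ?b n x \<partial>count_space S)"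
    by (intro mult_left_mono nn_integral_liminf) simp_all
  also have "\<dots> \<le> ?K * liminf (\<lambda>n. \<integral>\<^sup>+y. G n y \<partial>N)"
    by (intro mult_left_mono Liminf_mono always_eventually allI sum_disjoint_energy_le cS S(2) Gm) simp
  finally show ?thesis by (simp add: \<sigma>_def)
qed

text \<open>The boundary lies within \<open>diameter \<Omega>\<close> of any of its points, possibly
  with equality; \<open>3 / 2\<close> exceeds 1 so that one open ball covers it, and stays below the
  factor 2 up to which the bound holds.\<close>

lemma frontier_hausdorff_finite: "codim1_hausdorff \<mu> (frontier \<Omega>) < \<infinity>"
proof (cases "frontier \<Omega> = {}")
  case False
  then obtain x where x: "x \<in> frontier \<Omega>" by blast
  let ?d = "diameter \<Omega>"
  have d: "?d > 0" by (rule diameter_pos[OF x])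
  have "frontier \<Omega> \<subseteq> ball x (3 / 2 * ?d) \<inter> frontier \<Omega>"
  proof
    fix y assume y: "y \<in> frontier \<Omega>"
    have "dist x y \<le> diameter (closure \<Omega>)"
      using x y by (intro diameter_bounded_bound bounded_closure bounded_domain frontier_in_closure)
    then show "y \<in> ball x (3 / 2 * ?d) \<inter> frontier \<Omega>"
      using y d by (simp add: diameter_closure bounded_domain)
  qed
  then have "codim1_hausdorff \<mu> (frontier \<Omega>) \<le> codim1_hausdorff \<mu> (ball x (3 / 2 * ?d) \<inter> frontier \<Omega>)"
    by (rule codim1_hausdorff_mono)
  also have "\<dots> \<le> ennreal H * (\<mu> (ball x (3 / 2 * ?d)) / ennreal (3 / 2 * ?d))"
    using d by (intro codim1_upper[OF x]) auto
  also have "\<dots> = ennreal (H * (mass (ball x (3 / 2 * ?d)) / (3 / 2 * ?d)))"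
    using d H_pos by (subst ennreal_mult) (simp_all add: mu_eq_mass divide_ennreal)
  finally show ?thesis by (simp add: le_less_trans)
qed simp

definition trace_at :: "('a \<Rightarrow> real) \<Rightarrow> 'a \<Rightarrow> real \<Rightarrow> bool" where
  "trace_at u x a \<longleftrightarrow>
     ((\<lambda>r. (\<integral>\<^sup>+y\<in>\<Omega> \<inter> ball x r. ennreal \<bar>u y - a\<bar> \<partial>M) / \<mu> (\<Omega> \<inter> ball x r)) \<longlongrightarrow> 0) (at_right 0)"

text \<open>\<open>K\<close> is chosen before \<open>u\<close>, \<open>t\<close> and the ramps, so
  that the estimate can be integrated over the level.\<close>

lemma boundary_level_set_estimate:
  obtains K where "K > 0"
    "\<And>u w G t T. u \<in> borel_measurable N \<Longrightarrow> (\<And>n. w n \<in> borel_measurable N) \<Longrightarrow>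
      (\<And>n y. 0 \<le> w n y \<and> w n y \<le> (1 :: real)) \<Longrightarrow>
      (\<And>n::nat. upper_gradient_on \<Omega> (\<lambda>y. ereal (w n y)) (G n)) \<Longrightarrow>
      (\<lambda>n. \<integral>\<^sup>+y. ennreal \<bar>w n y - indicator {y\<in>\<Omega>. t < \<bar>u y\<bar>} y\<bar> \<partial>N) \<longlonglongrightarrow> 0 \<Longrightarrow>
      codim1_hausdorff \<mu> {x\<in>frontier \<Omega>. trace_at u x (T x) \<and> t < \<bar>T x\<bar>}
        \<le> ennreal K * (liminf (\<lambda>n. \<integral>\<^sup>+y. G n y \<partial>N) + emeasure N {y\<in>\<Omega>. t < \<bar>u y\<bar>})"
proof (cases "frontier \<Omega> = {}")
  case True
  show thesis by (rule that[of 1]) (simp_all add: True)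
next
  case False
  then obtain x0 where "x0 \<in> frontier \<Omega>" by blast
  then have d: "diameter \<Omega> > 0" by (rule diameter_pos)
  have L: "2 * L + 1 \<ge> 3" using L_ge_1 by simp
  have R: "0 < stop_scale" "stop_scale < diameter \<Omega>"
  proof -
    have "diameter \<Omega> * 1 < diameter \<Omega> * (3 * (2 * L + 1))"
      using d L by (intro mult_strict_left_mono) auto
    then show "0 < stop_scale" "stop_scale < diameter \<Omega>"
      using d L by (simp_all add: stop_scale_def divide_less_eq)
  qed
  obtain D where D: "D \<ge> 1" "\<And>x r. r > 0 \<Longrightarrow> \<mu> (ball x (2 * r)) \<le> ennreal D * \<mu> (ball x r)"
    using doubling_ball_scale[of 2] by blast
  obtain D3 where D3: "D3 \<ge> 1" "\<And>x r. r > 0 \<Longrightarrow> \<mu> (ball x (3 * (2 * L + 1) * r)) \<le> ennreal D3 * \<mu> (ball x r)"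
    using doubling_ball_scale[of "3 * (2 * L + 1)"] by blast
  \<comment> \<open>\<open>6 * (2 * L + 1) * stop_scale\<close> is twice the diameter, a radius at
    which a ball about a boundary point contains all of \<Omega>.\<close>
  obtain D2 where D2: "D2 \<ge> 1" "\<And>x r. r > 0 \<Longrightarrow> \<mu> (ball x (6 * (2 * L + 1) * r)) \<le> ennreal D2 * \<mu> (ball x r)"
    using doubling_ball_scale[of "6 * (2 * L + 1)"] by blast
  define \<kappa> where "\<kappa> = c / (2 * D)"
  have \<kappa>: "\<kappa> > 0" using c_pos D by (simp add: \<kappa>_def)
  define h where "h = enn2real (codim1_hausdorff \<mu> (frontier \<Omega>))"
  have h: "codim1_hausdorff \<mu> (frontier \<Omega>) = ennreal h" "h \<ge> 0"
    using frontier_hausdorff_finite by (simp_all add: h_def)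
  obtain z where "z \<in> \<Omega>" using \<open>x0 \<in> frontier \<Omega>\<close> by (force simp: frontier_def)
  then obtain e where e: "e > 0" "ball z e \<subseteq> \<Omega>" using open_domain by (auto simp: open_contains_ball)
  have m\<Omega>: "mass \<Omega> > 0"
    using mass_ball_pos[OF e(1)] mass_mono[OF e(2) bounded_domain] by (rule less_le_trans)
  define K1 where "K1 = H * D3 / (3 * (2 * L + 1)) * (4 * P / \<kappa>)"
  \<comment> \<open>If \<open>E\<close> fills more than half of the domain part of some ball at
    \<open>stop_scale\<close>, then \<open>mass \<Omega> \<le> 2 * D2 / c * mass E\<close>; this
    factor therefore makes \<open>K2 * mass E\<close> at least the Hausdorff measure
    \<open>h\<close> of the whole boundary.\<close>
  define K2 where "K2 = h * (2 * D2 / (c * mass \<Omega>))"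
  have K: "K1 > 0" "K2 \<ge> 0" using H_pos D3 L P_pos \<kappa> h D2 c_pos m\<Omega> by (auto simp: K1_def K2_def)
  show thesis
  proof (rule that[of "max K1 K2"])
    show "max K1 K2 > 0" using K by simp
    fix u :: "'a \<Rightarrow> real" and w :: "nat \<Rightarrow> 'a \<Rightarrow> real" and G t and T :: "'a \<Rightarrow> real"
    define E where "E = {y\<in>\<Omega>. t < \<bar>u y\<bar>}"
    assume u: "u \<in> borel_measurable N" and w: "\<And>n. w n \<in> borel_measurable N" "\<And>n y. 0 \<le> w n y \<and> w n y \<le> 1"
      and G: "\<And>n. upper_gradient_on \<Omega> (\<lambda>y. ereal (w n y)) (G n)"
      and "(\<lambda>n. \<integral>\<^sup>+y. ennreal \<bar>w n y - indicator {y\<in>\<Omega>. t < \<bar>u y\<bar>} y\<bar> \<partial>N) \<longlonglongrightarrow> 0"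
    then have conv: "(\<lambda>n. \<integral>\<^sup>+y. ennreal \<bar>w n y - indicator E y\<bar> \<partial>N) \<longlonglongrightarrow> 0" by (simp add: E_def)
    have "{y\<in>space N. t < \<bar>u y\<bar>} \<in> sets N" using u by measurable
    then have E: "E \<in> sets N" by (simp add: E_def)
    let ?A = "{x\<in>frontier \<Omega>. trace_at u x (T x) \<and> t < \<bar>T x\<bar>}"
    let ?l = "liminf (\<lambda>n. \<integral>\<^sup>+y. G n y \<partial>N)"
    have dens: "eventually (\<lambda>r. mass (\<Omega> \<inter> ball x r) < 2 * mass (E \<inter> ball x r)) (at_right 0)" if "x \<in> ?A" for x
      using that unfolding E_def trace_at_def by (intro level_set_density[OF u, where a = "T x"]) auto
    have "codim1_hausdorff \<mu> ?A \<le> ennreal K1 * ?l + ennreal K2 * emeasure N E"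
    proof (cases "\<forall>x\<in>?A. 2 * mass (E \<inter> ball x stop_scale) \<le> mass (\<Omega> \<inter> ball x stop_scale)")
      case True
      have "\<forall>x\<in>?A. \<exists>r. 0 < r \<and> r \<le> stop_scale \<and> \<kappa> * mass (ball x r) \<le> mass (E \<inter> ball x r) \<and>
          \<kappa> * mass (ball x r) \<le> mass (\<Omega> \<inter> ball x r - E)"
        unfolding \<kappa>_def
      proof
        fix x assume x: "x \<in> ?A"
        show "\<exists>r. 0 < r \<and> r \<le> stop_scale \<and> c / (2 * D) * mass (ball x r) \<le> mass (E \<inter> ball x r) \<and>
          c / (2 * D) * mass (ball x r) \<le> mass (\<Omega> \<inter> ball x r - E)"
          using x by (intro stopping_radius[OF D _ E R dens[OF x] True[rule_format, OF x]]) auto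
      qed
      then have "codim1_hausdorff \<mu> ?A \<le> ennreal K1 * ?l"
        unfolding K1_def by (intro switching_set_estimate[OF _ \<kappa> E w G conv _ D3]) auto
      then show ?thesis by (rule order_trans) simp
    next
      case False
      then obtain x where x: "x \<in> frontier \<Omega>"
        and big: "mass (\<Omega> \<inter> ball x stop_scale) < 2 * mass (E \<inter> ball x stop_scale)"
        by (auto simp: not_le)
      have "\<Omega> \<subseteq> ball x (2 * diameter \<Omega>)"
      proof
        fix y assume "y \<in> \<Omega>"
        then have "dist x y \<le> diameter (closure \<Omega>)"
          using frontier_in_closure[OF x] closure_subset[of \<Omega>]
          by (intro diameter_bounded_bound bounded_closure bounded_domain) auto
        then show "y \<in> ball x (2 * diameter \<Omega>)"
          using d by (simp add: diameter_closure bounded_domain)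
      qed
      also have "2 * diameter \<Omega> = 6 * (2 * L + 1) * stop_scale"
        using stop_scale_eq by (simp add: algebra_simps)
      finally have "\<mu> \<Omega> \<le> \<mu> (ball x (6 * (2 * L + 1) * stop_scale))" by (rule mu_mono)
      also have "\<dots> \<le> ennreal D2 * \<mu> (ball x stop_scale)" by (rule D2(2)[OF R(1)])
      finally have "ennreal (mass \<Omega>) \<le> ennreal D2 * ennreal (mass (ball x stop_scale))"
        using bounded_domain by (simp flip: mu_eq_mass)
      then have "mass \<Omega> \<le> D2 * mass (ball x stop_scale)" using D2(1) by (simp flip: ennreal_mult)
      then have "c * mass \<Omega> \<le> D2 * (c * mass (ball x stop_scale))" using c_pos by simp
      also have "\<dots> \<le> D2 * mass (\<Omega> \<inter> ball x stop_scale)"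
        using mass_density[OF x R] D2(1) by (intro mult_left_mono) auto
      also have "\<dots> \<le> D2 * (2 * mass (E \<inter> ball x stop_scale))"
        using big D2(1) by (intro mult_left_mono) auto
      also have "\<dots> \<le> D2 * (2 * mass E)"
        using D2(1) bounded_sets_N[OF E] by (intro mult_left_mono mass_mono) auto
      finally have "1 \<le> 2 * D2 / (c * mass \<Omega>) * mass E"
        using c_pos m\<Omega> by (simp add: field_simps)
      then have "h * 1 \<le> h * (2 * D2 / (c * mass \<Omega>) * mass E)" using h(2) by (rule mult_left_mono)
      then have "h \<le> K2 * mass E" by (simp add: K2_def mult.assoc)
      then have "ennreal h \<le> ennreal K2 * ennreal (mass E)"
        using K by (subst ennreal_mult[symmetric]) (auto intro: ennreal_leI)
      moreover have "codim1_hausdorff \<mu> ?A \<le> ennreal h"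
        unfolding h(1)[symmetric] by (intro codim1_hausdorff_mono) auto
      ultimately have "codim1_hausdorff \<mu> ?A \<le> ennreal K2 * emeasure N E"
        using E by (simp add: emeasure_N mu_eq_mass_N)
      then show ?thesis by (rule order_trans) simp
    qed
    also have "\<dots> \<le> ennreal (max K1 K2) * ?l + ennreal (max K1 K2) * emeasure N E"
      by (intro add_mono mult_right_mono ennreal_leI) auto
    finally show "codim1_hausdorff \<mu> ?A \<le> ennreal (max K1 K2) * (?l + emeasure N {y\<in>\<Omega>. t < \<bar>u y\<bar>})"
      by (simp add: E_def distrib_left)
  qed
qed


section \<open>Integration over the levels and passage to the infimum in the total variation\<close>

abbreviation "MH \<equiv> caratheodory_measure (codim1_hausdorff \<mu>)"

lemma space_MH [simp]: "space MH = UNIV"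
  by (simp add: caratheodory_measure_def space_measure_of_conv)

lemma emeasure_MH: "A \<in> sets MH \<Longrightarrow> emeasure MH A = codim1_hausdorff \<mu> A"
  by (simp add: sets_caratheodory_measure[OF outer_measure_space_codim1_hausdorff]
      emeasure_caratheodory_measure[OF outer_measure_space_codim1_hausdorff])

text \<open>The trace is not assumed to be measurable, so its integral is a lower integral, the supremum over
  the simple functions below it; the layer cake formula is applied to each of these.\<close>

lemma nn_integral_frontier_layer_cake_le:
  fixes f :: "'a \<Rightarrow> real"
  assumes f: "\<And>x. f x \<ge> 0"
    and le: "AE t in lborel. 0 < t \<longrightarrow> codim1_hausdorff \<mu> ({x\<in>frontier \<Omega>. t < f x} - Z) \<le> k t"
    and Z: "codim1_hausdorff \<mu> Z = 0"
  shows "(\<integral>\<^sup>+x\<in>frontier \<Omega>. ennreal (f x) \<partial>MH) \<le> (\<integral>\<^sup>+t\<in>{0<..}. k t \<partial>lborel)"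
  unfolding nn_integral_def[of MH]
proof (rule SUP_least)
  fix s assume "s \<in> {g. simple_function MH g \<and> g \<le> (\<lambda>x. ennreal (f x) * indicator (frontier \<Omega>) x)}"
  then have s: "simple_function MH s" and sf: "\<And>x. s x \<le> ennreal (f x) * indicator (frontier \<Omega>) x"
    by (auto simp: le_fun_def)
  define p where "p = (\<lambda>x. enn2real (s x))"
  have [measurable]: "s \<in> borel_measurable MH" using s by (rule borel_measurable_simple_function)
  have pm [measurable]: "p \<in> borel_measurable MH" unfolding p_def by measurable
  have "s x < top" for x
    using sf[of x] by (cases "x \<in> frontier \<Omega>") (auto intro: le_less_trans)
  then have sp: "s x = ennreal (p x)" for x by (simp add: p_def)
  have p0: "p x \<ge> 0" for x by (simp add: p_def)
  have p_le: "p x \<le> f x \<and> x \<in> frontier \<Omega>" if "p x > 0" for x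
    using sf[of x] that f[of x] by (cases "x \<in> frontier \<Omega>") (simp_all add: sp)
  \<comment> \<open>The layer cake formula requires a sigma-finite measure, which \<open>MH\<close>
    need not be. The set where \<open>p\<close> is positive lies in the boundary, so restricting to
    it gives a finite measure.\<close>
  define S where "S = {x. 0 < p x}"
  have "{x\<in>space MH. 0 < p x} \<in> sets MH" by measurable
  then have S: "S \<in> sets MH" by (simp add: S_def)
  have "emeasure MH S \<le> codim1_hausdorff \<mu> (frontier \<Omega>)"
    unfolding emeasure_MH[OF S] using p_le by (intro codim1_hausdorff_mono) (auto simp: S_def)
  then have fin: "emeasure MH S < \<infinity>" using frontier_hausdorff_finite by (rule le_less_trans)
  interpret S: finite_measure "restrict_space MH S"
    using fin S by (intro finite_measureI) (simp add: emeasure_restrict_space space_restrict_space)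
  have "integral\<^sup>S MH s = (\<integral>\<^sup>+x. s x \<partial>MH)" using s by (rule nn_integral_eq_simple_integral[symmetric])
  also have "\<dots> = (\<integral>\<^sup>+x. ennreal (p x) * indicator S x \<partial>MH)"
    using p0 by (intro nn_integral_cong) (auto simp: sp S_def indicator_def not_less intro: antisym)
  also have "\<dots> = (\<integral>\<^sup>+x. ennreal (p x) \<partial>restrict_space MH S)"
    using S by (subst nn_integral_restrict_space) auto
  also have "\<dots> = (\<integral>\<^sup>+t\<in>{0<..}. emeasure (restrict_space MH S) {x\<in>space (restrict_space MH S). t < p x} \<partial>lborel)"
    using p0 by (intro S.nn_integral_layer_cake measurable_restrict_space1) simp_all
  also have "\<dots> \<le> (\<integral>\<^sup>+t\<in>{0<..}. k t \<partial>lborel)"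
  proof (rule nn_integral_mono_AE)
    from le show "AE t in lborel. emeasure (restrict_space MH S) {x\<in>space (restrict_space MH S). t < p x} * indicator {0<..} t
        \<le> k t * indicator {0<..} t"
    proof eventually_elim
      case (elim t)
      show ?case
      proof (cases "0 < t")
        case True
        then have eq: "{x\<in>space (restrict_space MH S). t < p x} = {x\<in>space MH. t < p x}"
          by (auto simp: space_restrict_space S_def)
        have St: "{x\<in>space MH. t < p x} \<in> sets MH" by measurable
        have "{x\<in>space MH. t < p x} \<subseteq> S" using True by (auto simp: S_def)
        then have "emeasure (restrict_space MH S) {x\<in>space (restrict_space MH S). t < p x} = emeasure MH {x\<in>space MH. t < p x}"
          unfolding eq using S by (intro emeasure_restrict_space) auto
        also have "\<dots> = codim1_hausdorff \<mu> {x\<in>space MH. t < p x}" by (rule emeasure_MH[OF St])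
        \<comment> \<open>The superlevel set of the simple function is measurable; that of
          \<open>f\<close> need not be and enters only through the outer measure, up to the null set
          \<open>Z\<close>.\<close>
        also have "\<dots> \<le> codim1_hausdorff \<mu> (({x\<in>frontier \<Omega>. t < f x} - Z) \<union> Z)"
          using p_le True by (intro codim1_hausdorff_mono) (fastforce dest: less_trans)
        also have "\<dots> \<le> codim1_hausdorff \<mu> ({x\<in>frontier \<Omega>. t < f x} - Z) + codim1_hausdorff \<mu> Z"
          by (rule codim1_hausdorff_Un_le)
        also have "\<dots> \<le> k t" using elim True by (simp add: Z)
        finally show ?thesis using True by simp
      qed simp
    qed
  qed
  finally show "integral\<^sup>S MH s \<le> (\<integral>\<^sup>+t\<in>{0<..}. k t \<partial>lborel)" .
qed

lemma BV_measurable: "u \<in> BV \<mu> \<Omega> \<Longrightarrow> u \<in> borel_measurable N"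
  by (auto simp: BV_def set_integrable_def borel_measurable_restrict_space_iff dest: borel_measurable_integrable)

text \<open>The infimum in \<open>total_variation\<close> need not be attained, so
  \<open>bound\<close> works with any \<open>m\<close> above it; the excess \<open>e / K\<close>
  chosen at the end cancels the factor \<open>K\<close>.\<close>

lemma trace_integral_le:
  obtains K where "K > 0"
    "\<And>u T. u \<in> BV \<mu> \<Omega> \<Longrightarrow> is_trace \<mu> \<Omega> u T \<Longrightarrow>
      (\<integral>\<^sup>+x\<in>frontier \<Omega>. ennreal \<bar>T x\<bar> \<partial>MH) \<le> ennreal K * ((\<integral>\<^sup>+y\<in>\<Omega>. ennreal \<bar>u y\<bar> \<partial>M) + total_variation \<mu> \<Omega> u)"
proof -
  obtain K where K: "K > 0" and est:
    "\<And>u w G t T. u \<in> borel_measurable N \<Longrightarrow> (\<And>n. w n \<in> borel_measurable N) \<Longrightarrow>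
      (\<And>n y. 0 \<le> w n y \<and> w n y \<le> (1 :: real)) \<Longrightarrow>
      (\<And>n::nat. upper_gradient_on \<Omega> (\<lambda>y. ereal (w n y)) (G n)) \<Longrightarrow>
      (\<lambda>n. \<integral>\<^sup>+y. ennreal \<bar>w n y - indicator {y\<in>\<Omega>. t < \<bar>u y\<bar>} y\<bar> \<partial>N) \<longlonglongrightarrow> 0 \<Longrightarrow>
      codim1_hausdorff \<mu> {x\<in>frontier \<Omega>. trace_at u x (T x) \<and> t < \<bar>T x\<bar>}
        \<le> ennreal K * (liminf (\<lambda>n. \<integral>\<^sup>+y. G n y \<partial>N) + emeasure N {y\<in>\<Omega>. t < \<bar>u y\<bar>})"
    using boundary_level_set_estimate by blast
  have bound: "(\<integral>\<^sup>+x\<in>frontier \<Omega>. ennreal \<bar>T x\<bar> \<partial>MH) \<le> ennreal K * ((\<integral>\<^sup>+y. ennreal \<bar>u y\<bar> \<partial>N) + m)"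
    if u: "u \<in> borel_measurable N" and T: "is_trace \<mu> \<Omega> u T" and m: "total_variation \<mu> \<Omega> u < m" for u T m
  proof -
    obtain v g where v: "\<And>n. continuous_on \<Omega> (v n)"
      and g: "\<And>n::nat. upper_gradient_on \<Omega> (\<lambda>x. ereal (v n x)) (g n)"
      and gm: "\<And>n. (\<integral>\<^sup>+y. g n y \<partial>N) \<le> m"
      and conv: "AE y in N. (\<lambda>n. v n y) \<longlonglongrightarrow> u y"
      using total_variation_approximation[OF u m] by blast
    have vN: "v n \<in> borel_measurable N" for n
      using v by (intro borel_measurable_N borel_measurable_continuous_on_restrict)
    have gN: "g n \<in> borel_measurable N" for n
      using g[of n] by (intro borel_measurable_N) (simp add: upper_gradient_on_def)
    \<comment> \<open>Any positive null sequence would do, because the energy of the ramps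
      integrated over \<open>t\<close> does not depend on their width.\<close>
    define h where "h = (\<lambda>n. inverse (real (Suc n)))"
    have h: "h \<longlonglongrightarrow> 0" "\<And>n. h n > 0"
      unfolding h_def by (rule LIMSEQ_inverse_real_of_nat) simp
    define w where "w = (\<lambda>t n y. level_ramp t (h n) \<bar>v n y\<bar>)"
    define G where "G = (\<lambda>t n y. g n y * (ennreal (1 / h n) * indicator {t..t + h n} \<bar>v n y\<bar>))"
    have wN: "w t n \<in> borel_measurable N" for t n
      unfolding w_def level_ramp_def using vN[of n] by measurable
    have wb: "0 \<le> w t n y \<and> w t n y \<le> 1" for t n y
      unfolding w_def using level_ramp_bounds by blast
    have Gw: "upper_gradient_on \<Omega> (\<lambda>y. ereal (w t n y)) (G t n)" for t n
      unfolding w_def G_def by (rule upper_gradient_on_level_ramp[OF g v h(2)])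
    have absu: "(\<lambda>y. \<bar>u y\<bar>) \<in> borel_measurable N" using u by measurable
    obtain Z where Z: "{x. \<not> (x \<in> frontier \<Omega> \<longrightarrow> trace_at u x (T x))} \<subseteq> Z" "emeasure MH Z = 0" "Z \<in> sets MH"
      using T unfolding is_trace_def trace_at_def[symmetric] by (auto elim!: AE_E)
    have HZ: "codim1_hausdorff \<mu> Z = 0" using Z emeasure_MH by simp
    let ?a = "\<lambda>t. liminf (\<lambda>n. \<integral>\<^sup>+y. G t n y \<partial>N)"
    let ?e = "\<lambda>t. emeasure N {y\<in>\<Omega>. t < \<bar>u y\<bar>}"
    have "AE t in lborel. 0 < t \<longrightarrow> codim1_hausdorff \<mu> ({x\<in>frontier \<Omega>. t < \<bar>T x\<bar>} - Z) \<le> ennreal K * (?a t + ?e t)"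
      using N.AE_level_set_null[OF absu]
    proof eventually_elim
      case (elim t)
      have "codim1_hausdorff \<mu> ({x\<in>frontier \<Omega>. t < \<bar>T x\<bar>} - Z)
          \<le> codim1_hausdorff \<mu> {x\<in>frontier \<Omega>. trace_at u x (T x) \<and> t < \<bar>T x\<bar>}"
        using Z(1) by (intro codim1_hausdorff_mono) auto
      also have "\<dots> \<le> ennreal K * (?a t + ?e t)"
        using level_ramp_tendsto_L1[OF vN u conv h elim]
        by (intro est[OF u wN wb Gw]) (simp add: w_def)
      finally show ?case by simp
    qed
    then have "(\<integral>\<^sup>+x\<in>frontier \<Omega>. ennreal \<bar>T x\<bar> \<partial>MH) \<le> (\<integral>\<^sup>+t\<in>{0<..}. ennreal K * (?a t + ?e t) \<partial>lborel)"
      by (intro nn_integral_frontier_layer_cake_le[OF _ _ HZ]) simp_all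
    also have "\<dots> \<le> ennreal K * ((\<integral>\<^sup>+y. ennreal \<bar>u y\<bar> \<partial>N) + m)"
    proof -
      have aN: "(\<lambda>t. \<integral>\<^sup>+y. G t n y \<partial>N) \<in> borel_measurable lborel" for n
        unfolding G_def by (rule measurable_level_energy[OF vN gN])
      then have am: "?a \<in> borel_measurable lborel" by measurable
      have "?e t = (\<integral>\<^sup>+y. (if t < \<bar>u y\<bar> then 1 else 0) \<partial>N)" for t
      proof -
        have "{y\<in>space N. t < \<bar>u y\<bar>} \<in> sets N" using u by measurable
        then have "?e t = (\<integral>\<^sup>+y. indicator {y\<in>\<Omega>. t < \<bar>u y\<bar>} y \<partial>N)" by simp
        also have "\<dots> = (\<integral>\<^sup>+y. (if t < \<bar>u y\<bar> then 1 else 0) \<partial>N)"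
          by (intro nn_integral_cong) (auto simp: indicator_def)
        finally show ?thesis .
      qed
      moreover have "(\<lambda>t. \<integral>\<^sup>+y. (if t < \<bar>u y\<bar> then 1 else 0) \<partial>N) \<in> borel_measurable lborel"
        using u by measurable
      ultimately have em: "?e \<in> borel_measurable lborel" by simp
      have em': "(\<lambda>t. ?e t * indicator {0<..} t) \<in> borel_measurable lborel"
        by (intro borel_measurable_times_ennreal em) simp
      have "(\<integral>\<^sup>+t. ?a t \<partial>lborel) \<le> liminf (\<lambda>n. \<integral>\<^sup>+t. \<integral>\<^sup>+y. G t n y \<partial>N \<partial>lborel)"
        by (rule nn_integral_liminf[OF aN])
      also have "\<dots> = liminf (\<lambda>n. \<integral>\<^sup>+y. g n y \<partial>N)"
        unfolding G_def using nn_integral_level_energy[OF vN gN h(2)] by simp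
      also have "\<dots> \<le> liminf (\<lambda>n. m)"
        by (intro Liminf_mono always_eventually allI gm)
      also have "\<dots> = m" by (simp add: Liminf_const)
      finally have a: "(\<integral>\<^sup>+t. ?a t \<partial>lborel) \<le> m" .
      have e: "(\<integral>\<^sup>+t\<in>{0<..}. ?e t \<partial>lborel) = (\<integral>\<^sup>+y. ennreal \<bar>u y\<bar> \<partial>N)"
        using N.nn_integral_layer_cake[OF absu] by simp
      \<comment> \<open>The restriction to positive levels is kept for the measure term only; the
        energy term is integrated over the whole real line, where its integral has already been
        bounded by \<open>m\<close>.\<close>
      have "(\<integral>\<^sup>+t\<in>{0<..}. ennreal K * (?a t + ?e t) \<partial>lborel)
          \<le> (\<integral>\<^sup>+t. ennreal K * (?a t + ?e t * indicator {0<..} t) \<partial>lborel)"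
        by (intro nn_integral_mono) (auto simp: indicator_def)
      also have "\<dots> = ennreal K * (\<integral>\<^sup>+t. ?a t + ?e t * indicator {0<..} t \<partial>lborel)"
        using am em' by (intro nn_integral_cmult borel_measurable_add)
      also have "\<dots> = ennreal K * ((\<integral>\<^sup>+t. ?a t \<partial>lborel) + (\<integral>\<^sup>+t\<in>{0<..}. ?e t \<partial>lborel))"
        using am em' by (subst nn_integral_add) simp_all
      also have "\<dots> \<le> ennreal K * ((\<integral>\<^sup>+y. ennreal \<bar>u y\<bar> \<partial>N) + m)"
        unfolding e using a by (intro mult_left_mono) (simp_all add: add.commute add_left_mono)
      finally show ?thesis .
    qed
    finally show ?thesis .
  qed
  show thesis
  proof (rule that[OF K])
    fix u T assume uBV: "u \<in> BV \<mu> \<Omega>" and T: "is_trace \<mu> \<Omega> u T"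
    let ?V = "total_variation \<mu> \<Omega> u"
    have V: "?V < top" using uBV by (simp add: BV_def)
    show "(\<integral>\<^sup>+x\<in>frontier \<Omega>. ennreal \<bar>T x\<bar> \<partial>MH) \<le> ennreal K * ((\<integral>\<^sup>+y\<in>\<Omega>. ennreal \<bar>u y\<bar> \<partial>M) + ?V)"
    proof (rule ennreal_le_epsilon)
      fix e :: real assume e: "0 < e"
      have "?V < ?V + ennreal (e / K)"
        using V e K by (cases ?V) (simp_all flip: ennreal_plus add: ennreal_less_iff)
      from bound[OF BV_measurable[OF uBV] T this]
      have "(\<integral>\<^sup>+x\<in>frontier \<Omega>. ennreal \<bar>T x\<bar> \<partial>MH)
          \<le> ennreal K * ((\<integral>\<^sup>+y\<in>\<Omega>. ennreal \<bar>u y\<bar> \<partial>M) + (?V + ennreal (e / K)))"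
        unfolding nn_integral_N .
      also have "\<dots> = ennreal K * ((\<integral>\<^sup>+y\<in>\<Omega>. ennreal \<bar>u y\<bar> \<partial>M) + ?V) + ennreal K * ennreal (e / K)"
        by (simp add: distrib_left add.assoc)
      also have "ennreal K * ennreal (e / K) = ennreal e"
        using K e by (simp flip: ennreal_mult)
      finally show "(\<integral>\<^sup>+x\<in>frontier \<Omega>. ennreal \<bar>T x\<bar> \<partial>MH)
          \<le> ennreal K * ((\<integral>\<^sup>+y\<in>\<Omega>. ennreal \<bar>u y\<bar> \<partial>M) + ?V) + ennreal e" .
    qed
  qed
qed

end

theorem theorem5p5:
  fixes \<mu> :: "'a::complete_space set \<Rightarrow> ennreal"
    and \<Omega> :: "'a set"
    and C\<^sub>d C\<^sub>P \<Lambda> c\<^sub>m :: real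
  assumes "borel_regular_outer_measure \<mu>"
    and "doubling \<mu> C\<^sub>d"
    and "poincare_inequality_on \<mu> UNIV C\<^sub>P \<Lambda>"
    and "open \<Omega>" "connected \<Omega>" "bounded \<Omega>"
    and "supports_poincare \<mu> \<Omega>"
    and "c\<^sub>m > 0"
    and "\<forall>x\<in>frontier \<Omega>. \<forall>r\<in>{0<..<diameter \<Omega>}.
           ennreal c\<^sub>m * \<mu> (ball x r) \<le> \<mu> (ball x r \<inter> \<Omega>)"
    and "\<exists>C>0. \<forall>x\<in>frontier \<Omega>. \<forall>r\<in>{0<..<2 * diameter \<Omega>}.
           codim1_hausdorff \<mu> (ball x r \<inter> frontier \<Omega>) \<le> ennreal C * (\<mu> (ball x r) / ennreal r)"
  shows "\<exists>C\<^sub>T>0. \<forall>u\<in>BV \<mu> \<Omega>. \<forall>Tu. is_trace \<mu> \<Omega> u Tu \<longrightarrow>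
           (\<integral>\<^sup>+x\<in>frontier \<Omega>. ennreal \<bar>Tu x\<bar> \<partial>caratheodory_measure (codim1_hausdorff \<mu>))
           \<le> ennreal C\<^sub>T * ((\<integral>\<^sup>+y\<in>\<Omega>. ennreal \<bar>u y\<bar> \<partial>caratheodory_measure \<mu>) + total_variation \<mu> \<Omega> u)"
proof -
  obtain P L where "poincare_inequality_on \<mu> \<Omega> P L"
    using assms(7) by (auto simp: supports_poincare_def)
  moreover obtain H where "H > 0" "\<forall>x\<in>frontier \<Omega>. \<forall>r\<in>{0<..<2 * diameter \<Omega>}.
      codim1_hausdorff \<mu> (ball x r \<inter> frontier \<Omega>) \<le> ennreal H * (\<mu> (ball x r) / ennreal r)"
    using assms(10) by blast
  ultimately interpret trace_domain \<mu> C\<^sub>d \<Omega> P L c\<^sub>m H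
    by unfold_locales (use assms in simp_all)
  obtain K where "K > 0" "\<And>u T. u \<in> BV \<mu> \<Omega> \<Longrightarrow> is_trace \<mu> \<Omega> u T \<Longrightarrow>
      (\<integral>\<^sup>+x\<in>frontier \<Omega>. ennreal \<bar>T x\<bar> \<partial>MH) \<le> ennreal K * ((\<integral>\<^sup>+y\<in>\<Omega>. ennreal \<bar>u y\<bar> \<partial>M) + total_variation \<mu> \<Omega> u)"
    by (rule trace_integral_le) (rule that)
  then show ?thesis by (intro exI[of _ K]) simp
qed

end
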